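(* Let $G=\mathrm{SL}_3$ over $\mathbb{F}_q$, $T$ the diagonal torus, and $\mathcal{B}_T$ the set of the six Borel subgroups of $G$ containing $T$. For $B\in\mathcal{B}_T$ let $(\Phi^\vee)^+_B$ be the set of positive coroots for $B$ and, for a coroot $\alpha^\vee$, let $T_{\alpha^\vee}$ be the corresponding one-dimensional subtorus of $T$. Let $\mathcal{S}'(\overline{\mathrm{SL}_3/U(B)}(\mathbb{F}_q),\mathbb{C})$ be the space of functions $f:\overline{G/U(B)}(\mathbb{F}_q)\to\mathbb{C}$ whose average under the right action of $T_{\alpha^\vee}$ is $0$ for each $\alpha^\vee\in(\Phi^\vee)^+_B$, i.e. $\sum_{t\in\mathbb{F}_q^\times}f(x\cdot\alpha^\vee(t))=0$ for all $x\in\overline{G/U(B)}(\mathbb{F}_q)$. (i) The transforms $$q^{-1}\mathcal{F}_{BK_{B',B}}:\mathcal{S}'(\overline{\mathrm{SL}_3/U(B)}(\mathbb{F}_q),\mathbb{C})\to\mathcal{S}'(\overline{\mathrm{SL}_3/U(B')}(\mathbb{F}_q),\mathbb{C})$$ for adjacent Borels $B,B'$ (defined explicitly in the context by fiberwise Fourier transforms) generate a family of normalized intertwining operators between any pair $B,B'\in\mathcal{B}_T$: there is a unique family of $G(\mathbb{F}_q)\times T(\mathbb{F}_q)$-equivariant linear maps $\mathcal{F}_{B',B}:\mathcal{S}'(\overline{\mathrm{SL}_3/U(B)}(\mathbb{F}_q),\mathbb{C})\to\mathcal{S}'(\overline{\mathrm{SL}_3/U(B')}(\mathbb{F}_q),\mathbb{C})$,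 $B,B'\in\mathcal{B}_T$, with $\mathcal{F}_{B,B}=\mathrm{Id}$, $\mathcal{F}_{B'',B'}\circ\mathcal{F}_{B',B}=\mathcal{F}_{B'',B}$ for all $B,B',B''$, and $\mathcal{F}_{B',B}=q^{-1}\mathcal{F}_{BK_{B',B}}$ for $B,B'$ adjacent. (ii) For opposite Borels $B,B^{\mathrm{op}}\in\mathcal{B}_T$ the intertwiner $\mathcal{F}_{B^{\mathrm{op}},B}$ equals $q^{-3}\mathcal{F}$, where, in the models of the context, $$\mathcal{F}(f)(v,v^\vee)=\sum_{(u,u^\vee)\in X(\mathbb{F}_q)}f(u,u^\vee)\,\mathrm{Kl}\big(\langle u,v^\vee\rangle+\langle v,u^\vee\rangle\big).$$
   Context: Fix a nontrivial additive character $\psi:\mathbb{F}_q\to\mathbb{C}^\times$ and put $\mathrm{Kl}(a)=\sum_{t\in\mathbb{F}_q^\times}\psi\left(\frac at+t\right)$. $U(B)$ is the unipotent radical of $B$, and $\overline{G/U(B)}=\mathrm{Spec}\,\mathbb{F}_q[G/U(B)]$ is the affine closure of $G/U(B)$. The group $G\times T$ acts on functions by $((g,t)f)(x)=f(g^{-1}xt)$. Models. Let $V=\mathbb{A}^3$ (column vectors), $V^*$ the dual space (row vectors), $X=\{(v,v^\vee)\in V\times V^*:\langle v,v^\vee\rangle=0\}$. The Borels containing $T$ are $B_w=n_wB_en_w^{-1}$, $w\in S_3$, where $B_e$ is the upper triangular Borel and $n_w$ is a lift to the normalizer of $T$ of the permutation $e_i\mapsto e_{w(i)}$. Each $\overline{G/U(B_w)}$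 is identified with $X$ by the isomorphism induced by $gU(B_w)\mapsto(c_{w(1)},\bar r_{w(3)})$, where $c_i$ is the $i$-th column of $g$ and $\bar r_i$ is the $i$-th row of $g^{-1}$. Two Borels $B_w,B_{w'}$ are adjacent if $w'=ws$ with $s\in\{(1\,2),(2\,3)\}$, and opposite if $w'=w\cdot(1\,3)$. Adjacent transforms. Identify vectors and covectors with $\mathbb{F}_q^3$; for $c\neq0$ and $a,b$ both orthogonal to $c$, $\frac{a\times b}{c}$ is the scalar $\mu$ with $a\times b=\mu c$ (cross product). In the models, if $w'=w\cdot(1\,2)$ (so the second component $\bar r_{w(3)}$ is unchanged), $$\mathcal{F}_{BK_{B_{w'},B_w}}(f)(v,v^\vee)=\sum_{u\in(v^\vee)^\perp}f(u,v^\vee)\,\psi\left(\frac{u\times v}{v^\vee}\right)\quad(v^\vee\neq0),$$ with value $0$ when $v^\vee=0$; if $w'=w\cdot(2\,3)$ (so the first component $c_{w(1)}$ is unchanged), $$\mathcal{F}_{BK_{B_{w'},B_w}}(f)(v,v^\vee)=\sum_{u^\vee\in v^\perp}f(v,u^\vee)\,\psi\left(\frac{u^\vee\times v^\vee}{v}\right)\quad(v\neq0),$$ with value $0$ when $v=0$. *)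

theory Defs
  imports "HOL-Analysis.Analysis" "HOL-Combinatorics.Perm"
begin

unbundle permutation_syntax

text \<open>
  Everything lives over the finite field with \<open>q = CARD('k)\<close> elements. The permutation group on
  three letters is \<^typ>\<open>3 perm\<close>, where \<open>(u * v) \<langle>$\<rangle> i = u \<langle>$\<rangle> (v \<langle>$\<rangle> i)\<close>. In the index type
  \<^typ>\<open>3\<close> the numerals \<open>1, 2, 3\<close> are distinct and exhaustive, but \<open>3 = 0\<close>; hence its built-in
  order is not \<open>1 < 2 < 3\<close> and is never used below.
\<close>

definition SL3 :: "('k::field ^ 3 ^ 3) set" where
  "SL3 = {g. det g = 1}"

definition torus :: "('k::field ^ 3 ^ 3) set" where
  "torus = {t \<in> SL3. \<forall>i j. i \<noteq> j \<longrightarrow> t $ i $ j = 0}"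

definition borel_e :: "('k::field ^ 3 ^ 3) set" where
  "borel_e = {b \<in> SL3. b $ 2 $ 1 = 0 \<and> b $ 3 $ 1 = 0 \<and> b $ 3 $ 2 = 0}"

definition unip_e :: "('k::field ^ 3 ^ 3) set" where
  "unip_e = {b \<in> borel_e. \<forall>i. b $ i $ i = 1}"

definition is_lift :: "3 perm \<Rightarrow> 'k::field ^ 3 ^ 3 \<Rightarrow> bool" where
  "is_lift w n \<longleftrightarrow> n \<in> SL3 \<and> (\<forall>i j. n $ i $ j \<noteq> 0 \<longleftrightarrow> i = w \<langle>$\<rangle> j)"

text \<open>
  Two lifts of the same permutation differ by a right factor in the torus, so letting \<open>n\<close> run
  over all lifts gives the same subgroup as fixing one.
\<close>

definition borel_at :: "3 perm \<Rightarrow> ('k::field ^ 3 ^ 3) set" where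
  "borel_at w = {n ** b ** matrix_inv n | n b. is_lift w n \<and> b \<in> borel_e}"

definition unip_at :: "3 perm \<Rightarrow> ('k::field ^ 3 ^ 3) set" where
  "unip_at w = {n ** b ** matrix_inv n | n b. is_lift w n \<and> b \<in> unip_e}"

definition adjacent :: "3 perm \<Rightarrow> 3 perm \<Rightarrow> bool" where
  "adjacent w w' \<longleftrightarrow> w' = w * \<langle>1 \<leftrightarrow> 2\<rangle> \<or> w' = w * \<langle>2 \<leftrightarrow> 3\<rangle>"

definition opposite :: "3 perm \<Rightarrow> 3 perm \<Rightarrow> bool" where
  "opposite w w' \<longleftrightarrow> w' = w * \<langle>1 \<leftrightarrow> 3\<rangle>"

text \<open>
  The pair \<open>(i, j)\<close> with \<open>i \<noteq> j\<close> stands for the root \<open>\<epsilon>\<^sub>i - \<epsilon>\<^sub>j\<close> and its coroot; positivity for a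
  Borel subgroup means that the corresponding root subgroup is contained in it.
\<close>

definition coroot :: "3 \<Rightarrow> 3 \<Rightarrow> 'k::field \<Rightarrow> 'k ^ 3 ^ 3" where
  "coroot i j t = (\<chi> a b. if a \<noteq> b then 0 else if a = i then t else if a = j then inverse t else 1)"

definition root_elt :: "3 \<Rightarrow> 3 \<Rightarrow> 'k::field \<Rightarrow> 'k ^ 3 ^ 3" where
  "root_elt i j c = (\<chi> a b. if a = b then 1 else if a = i \<and> b = j then c else 0)"

definition pos_coroots :: "('k::field ^ 3 ^ 3) set \<Rightarrow> (3 \<times> 3) set" where
  "pos_coroots B = {(i, j). i \<noteq> j \<and> (\<forall>c. root_elt i j c \<in> B)}"

type_synonym 'k pt = "('k ^ 3) \<times> ('k ^ 3)"

definition quadric :: "'k::field pt set" where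
  "quadric = {(v, y). scalar_product v y = 0}"

text \<open>
  \<open>model w\<close> is the map \<open>g \<mapsto> (c\<^bsub>w(1)\<^esub>, r\<^bsub>w(3)\<^esub>)\<close> inducing the identification of the affine
  closure of \<open>SL3 / unip_at w\<close> with \<open>quadric\<close>. The two actions on pairs are the ones transported
  along it; the right action of the torus therefore depends on \<open>w\<close>. The lemmas \<open>model_equivariant\<close> and
  \<open>model_eq_iff\<close> below confirm that the actions are the right ones and that the fibres of
  \<open>model w\<close> on \<open>SL3\<close> are the cosets of \<open>unip_at w\<close>.
\<close>

definition model :: "3 perm \<Rightarrow> 'k::field ^ 3 ^ 3 \<Rightarrow> 'k pt" where
  "model w g = (column (w \<langle>$\<rangle> 1) g, row (w \<langle>$\<rangle> 3) (matrix_inv g))"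

definition left_act :: "'k::field ^ 3 ^ 3 \<Rightarrow> 'k pt \<Rightarrow> 'k pt" where
  "left_act g = (\<lambda>(v, y). (g *v v, y v* matrix_inv g))"

definition right_act :: "3 perm \<Rightarrow> 'k::field pt \<Rightarrow> 'k ^ 3 ^ 3 \<Rightarrow> 'k pt" where
  "right_act w = (\<lambda>(v, y) t. (t $ (w \<langle>$\<rangle> 1) $ (w \<langle>$\<rangle> 1) *s v,
                               inverse (t $ (w \<langle>$\<rangle> 3) $ (w \<langle>$\<rangle> 3)) *s y))"

definition act_fun :: "3 perm \<Rightarrow> 'k::field ^ 3 ^ 3 \<Rightarrow> 'k ^ 3 ^ 3 \<Rightarrow> ('k pt \<Rightarrow> complex) \<Rightarrow> 'k pt \<Rightarrow> complex" where
  "act_fun w g t f = (\<lambda>x. f (right_act w (left_act (matrix_inv g) x) t))"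

text \<open>
  A function on \<open>quadric\<close> is represented by its extension by zero.
\<close>

definition S' :: "3 perm \<Rightarrow> ('k::{field,finite} pt \<Rightarrow> complex) set" where
  "S' w = {f. (\<forall>x. x \<notin> quadric \<longrightarrow> f x = 0) \<and>
              (\<forall>(i, j) \<in> pos_coroots (borel_at w :: ('k ^ 3 ^ 3) set). \<forall>x \<in> quadric.
                 (\<Sum>t \<in> UNIV - {0}. f (right_act w x (coroot i j t))) = 0)}"

definition nontrivial_additive_character :: "('k::field \<Rightarrow> complex) \<Rightarrow> bool" where
  "nontrivial_additive_character \<psi> \<longleftrightarrow>
     (\<forall>x. \<psi> x \<noteq> 0) \<and> (\<forall>x y. \<psi> (x + y) = \<psi> x * \<psi> y) \<and> (\<exists>x. \<psi> x \<noteq> 1)"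

definition Kl :: "('k::{field,finite} \<Rightarrow> complex) \<Rightarrow> 'k \<Rightarrow> complex" where
  "Kl \<psi> a = (\<Sum>t \<in> UNIV - {0}. \<psi> (a / t + t))"

definition cross :: "'k::field ^ 3 \<Rightarrow> 'k ^ 3 \<Rightarrow> 'k ^ 3" where
  "cross a b = vector [a $ 2 * b $ 3 - a $ 3 * b $ 2,
                       a $ 3 * b $ 1 - a $ 1 * b $ 3,
                       a $ 1 * b $ 2 - a $ 2 * b $ 1]"

definition cross_quot :: "'k::field ^ 3 \<Rightarrow> 'k ^ 3 \<Rightarrow> 'k ^ 3 \<Rightarrow> 'k" where
  "cross_quot a b c = (THE \<mu>. cross a b = \<mu> *s c)"

definition BK12 :: "('k::{field,finite} \<Rightarrow> complex) \<Rightarrow> ('k pt \<Rightarrow> complex) \<Rightarrow> 'k pt \<Rightarrow> complex" where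
  "BK12 \<psi> f = (\<lambda>(v, y). if (v, y) \<notin> quadric \<or> y = 0 then 0
     else \<Sum>u | scalar_product u y = 0. f (u, y) * \<psi> (cross_quot u v y))"

definition BK23 :: "('k::{field,finite} \<Rightarrow> complex) \<Rightarrow> ('k pt \<Rightarrow> complex) \<Rightarrow> 'k pt \<Rightarrow> complex" where
  "BK23 \<psi> f = (\<lambda>(v, y). if (v, y) \<notin> quadric \<or> v = 0 then 0
     else \<Sum>z | scalar_product v z = 0. f (v, z) * \<psi> (cross_quot z y v))"

text \<open>\<open>BK \<psi> w' w\<close> is meaningful only for adjacent \<open>w\<close> and \<open>w'\<close>.\<close>

definition BK :: "('k::{field,finite} \<Rightarrow> complex) \<Rightarrow> 3 perm \<Rightarrow> 3 perm
    \<Rightarrow> ('k pt \<Rightarrow> complex) \<Rightarrow> 'k pt \<Rightarrow> complex" where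
  "BK \<psi> w' w = (if w' = w * \<langle>1 \<leftrightarrow> 2\<rangle> then BK12 \<psi> else BK23 \<psi>)"

definition Kl_transform :: "('k::{field,finite} \<Rightarrow> complex) \<Rightarrow> ('k pt \<Rightarrow> complex) \<Rightarrow> 'k pt \<Rightarrow> complex" where
  "Kl_transform \<psi> f = (\<lambda>(v, y). if (v, y) \<notin> quadric then 0
     else \<Sum>(u, z) \<in> quadric. f (u, z) * Kl \<psi> (scalar_product u y + scalar_product v z))"

definition linear_on_S' :: "3 perm \<Rightarrow> (('k::{field,finite} pt \<Rightarrow> complex) \<Rightarrow> 'k pt \<Rightarrow> complex) \<Rightarrow> bool" where
  "linear_on_S' w L \<longleftrightarrow>
     (\<forall>f \<in> S' w. \<forall>g \<in> S' w. L (\<lambda>x. f x + g x) = (\<lambda>x. L f x + L g x)) \<and>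
     (\<forall>c. \<forall>f \<in> S' w. L (\<lambda>x. c * f x) = (\<lambda>x. c * L f x))"

definition equivariant_on_S' :: "3 perm \<Rightarrow> 3 perm
    \<Rightarrow> (('k::{field,finite} pt \<Rightarrow> complex) \<Rightarrow> 'k pt \<Rightarrow> complex) \<Rightarrow> bool" where
  "equivariant_on_S' w' w L \<longleftrightarrow>
     (\<forall>g \<in> SL3. \<forall>t \<in> torus. \<forall>f \<in> S' w. L (act_fun w g t f) = act_fun w' g t (L f))"

text \<open>
  \<open>F w' w\<close> is the operator from \<open>S' w\<close> to \<open>S' w'\<close>. The extensional function space fixes its value
  outside \<open>S' w\<close>, so that equality of families is equality of the operators on these spaces.
  Indexing by permutations is indexing by Borel subgroups, by \<open>inj_borel_at\<close> below.
\<close>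

definition intertwining_family :: "('k::{field,finite} \<Rightarrow> complex)
    \<Rightarrow> (3 perm \<Rightarrow> 3 perm \<Rightarrow> ('k pt \<Rightarrow> complex) \<Rightarrow> 'k pt \<Rightarrow> complex) \<Rightarrow> bool" where
  "intertwining_family \<psi> F \<longleftrightarrow>
     (\<forall>w' w. F w' w \<in> S' w \<rightarrow>\<^sub>E S' w' \<and> linear_on_S' w (F w' w) \<and> equivariant_on_S' w' w (F w' w)) \<and>
     (\<forall>w. \<forall>f \<in> S' w. F w w f = f) \<and>
     (\<forall>w'' w' w. \<forall>f \<in> S' w. F w'' w' (F w' w f) = F w'' w f) \<and>
     (\<forall>w' w. adjacent w w' \<longrightarrow>
        (\<forall>f \<in> S' w. F w' w f = (\<lambda>x. BK \<psi> w' w f x / of_nat CARD('k))))"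

lemma matrix_inv_eqI:
  fixes a b :: "'k::field ^ 'n ^ 'n"
  assumes "a ** b = mat 1"
  shows "matrix_inv a = b"
proof -
  have ba: "b ** a = mat 1" using assms matrix_left_right_inverse by blast
  have "matrix_inv a ** a = mat 1"
    unfolding matrix_inv_def by (rule someI2[of _ b]) (use assms ba in auto)
  then have "matrix_inv a ** (a ** b) = b" by (simp add: matrix_mul_assoc)
  then show ?thesis by (simp add: assms)
qed

lemma SL3_inv:
  fixes g :: "'k::field ^ 3 ^ 3"
  assumes "g \<in> SL3"
  shows "g ** matrix_inv g = mat 1" "matrix_inv g ** g = mat 1"
proof -
  have "invertible g" using assms by (simp add: SL3_def invertible_det_nz)
  then obtain b where b: "g ** b = mat 1" unfolding invertible_def by blast
  then show "g ** matrix_inv g = mat 1" using matrix_inv_eqI[OF b] by simp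
  then show "matrix_inv g ** g = mat 1" by (simp add: matrix_left_right_inverse)
qed

lemma torus_inv:
  fixes t :: "'k::field ^ 3 ^ 3"
  assumes "t \<in> torus"
  shows "matrix_inv t = (\<chi> i j. if i = j then inverse (t $ i $ i) else 0)"
proof (rule matrix_inv_eqI)
  have "det t = 1" and off: "\<And>i j. i \<noteq> j \<Longrightarrow> t $ i $ j = 0"
    using assms by (auto simp: torus_def SL3_def)
  then have "t $ 1 $ 1 * t $ 2 $ 2 * t $ 3 $ 3 = 1" by (simp add: det_3)
  then have "t $ 1 $ 1 \<noteq> 0 \<and> t $ 2 $ 2 \<noteq> 0 \<and> t $ 3 $ 3 \<noteq> 0" by auto
  then show "t ** (\<chi> i j. if i = j then inverse (t $ i $ i) else 0) = mat 1"
    by (simp add: vec_eq_iff forall_3 matrix_matrix_mult_def mat_def sum_3 off)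
qed

lemma model_equivariant:
  fixes g h t :: "'k::field ^ 3 ^ 3"
  assumes "g \<in> SL3" "h \<in> SL3" "t \<in> torus"
  shows "model w (h ** g ** t) = right_act w (left_act h (model w g)) t"
proof -
  have tS: "t \<in> SL3" and off: "\<And>i j. i \<noteq> j \<Longrightarrow> t $ i $ j = 0"
    using assms by (auto simp: torus_def)
  have "(h ** g ** t) ** (matrix_inv t ** matrix_inv g ** matrix_inv h)
      = h ** (g ** ((t ** matrix_inv t) ** matrix_inv g)) ** matrix_inv h"
    by (simp add: matrix_mul_assoc)
  then have "(h ** g ** t) ** (matrix_inv t ** matrix_inv g ** matrix_inv h) = mat 1"
    by (simp add: SL3_inv assms tS)
  then have inv: "matrix_inv (h ** g ** t) = matrix_inv t ** matrix_inv g ** matrix_inv h"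
    by (rule matrix_inv_eqI)
  have "\<forall>i. column i (h ** g ** t) = t $ i $ i *s (h *v column i g)"
    by (simp add: forall_3 vec_eq_iff column_def matrix_matrix_mult_def matrix_vector_mult_def
        sum_3 off algebra_simps)
  moreover have "\<forall>i. row i (matrix_inv t ** matrix_inv g ** matrix_inv h)
      = inverse (t $ i $ i) *s (row i (matrix_inv g) v* matrix_inv h)"
    by (simp add: forall_3 vec_eq_iff row_def matrix_matrix_mult_def vector_matrix_mult_def
        sum_3 torus_inv[OF assms(3)] algebra_simps)
  ultimately show ?thesis
    by (simp add: model_def right_act_def left_act_def inv)
qed

lemma perm3_distinct:
  fixes w :: "3 perm"
  shows "w \<langle>$\<rangle> i = w \<langle>$\<rangle> j \<longleftrightarrow> i = j"
  by (rule apply_inj)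

lemma perm3_exhaust:
  fixes w :: "3 perm"
  obtains k where "a = w \<langle>$\<rangle> k"
  by (metis bij_apply bij_pointE)

lemma lift_inv:
  fixes n :: "'k::field ^ 3 ^ 3"
  assumes "is_lift w n"
  shows "matrix_inv n = (\<chi> i j. if j = w \<langle>$\<rangle> i then inverse (n $ j $ i) else 0)"
proof -
  have z: "n $ i $ j = 0 \<longleftrightarrow> i \<noteq> w \<langle>$\<rangle> j" for i j
    using assms by (auto simp: is_lift_def)
  have "(\<chi> i j. if j = w \<langle>$\<rangle> i then inverse (n $ j $ i) else 0) ** n = mat 1"
    by (auto simp: vec_eq_iff matrix_matrix_mult_def mat_def z perm3_distinct if_distrib
        if_distribR cong: if_cong)
  then show ?thesis
    by (intro matrix_inv_eqI) (simp add: matrix_left_right_inverse)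
qed

lemma conj_entry:
  fixes n b :: "'k::field ^ 3 ^ 3"
  assumes "is_lift w n"
  shows "(n ** b ** matrix_inv n) $ (w \<langle>$\<rangle> i) $ (w \<langle>$\<rangle> j)
       = n $ (w \<langle>$\<rangle> i) $ i * b $ i $ j * inverse (n $ (w \<langle>$\<rangle> j) $ j)"
proof -
  define d where "d = (\<lambda>i. n $ (w \<langle>$\<rangle> i) $ i)"
  have z: "n $ (w \<langle>$\<rangle> i) $ k = (if k = i then d i else 0)" for i k
    using assms perm3_distinct[of w] unfolding is_lift_def d_def by metis
  show ?thesis
    by (simp add: matrix_matrix_mult_def lift_inv[OF assms] perm3_distinct z if_distrib
        if_distribR cong: if_cong)
qed

lemma lift_exists:
  obtains n :: "'k::field ^ 3 ^ 3" where "is_lift w n"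
proof -
  define P :: "'k ^ 3 ^ 3" where "P = (\<chi> i j. if i = w \<langle>$\<rangle> j then 1 else 0)"
  define D :: "'k ^ 3 ^ 3" where "D = (\<chi> i j. if i \<noteq> j then 0 else if i = 1 then inverse (det P) else 1)"
  have "P $ k $ i * P $ k $ j = (if k = w \<langle>$\<rangle> i then if i = j then 1 else 0 else 0)" for i j k
    by (auto simp: P_def perm3_distinct)
  then have "transpose P ** P = mat 1"
    by (simp add: vec_eq_iff matrix_matrix_mult_def transpose_def mat_def)
  then have "det P \<noteq> 0" by (metis det_I det_mul mult_zero_right zero_neq_one)
  moreover have "det D = inverse (det P)" by (simp add: det_3 D_def)
  ultimately have "det (P ** D) = 1" by (simp add: det_mul)
  moreover have "(P ** D) $ i $ j = (if i = w \<langle>$\<rangle> j then D $ j $ j else 0)" for i j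
  proof -
    have "P $ i $ k * D $ k $ j = (if k = j then if i = w \<langle>$\<rangle> j then D $ j $ j else 0 else 0)" for k
      by (auto simp: P_def D_def)
    then show ?thesis by (simp add: matrix_matrix_mult_def)
  qed
  moreover have "D $ j $ j \<noteq> 0" for j using \<open>det P \<noteq> 0\<close> by (simp add: D_def)
  ultimately have "is_lift w (P ** D)" by (auto simp: is_lift_def SL3_def)
  then show thesis by (rule that)
qed

lemma conj_obtain:
  fixes g :: "'k::field ^ 3 ^ 3"
  assumes "g \<in> SL3"
  obtains n b where "is_lift w n" "b \<in> SL3" "g = n ** b ** matrix_inv n"
proof -
  obtain n :: "'k ^ 3 ^ 3" where n: "is_lift w n" by (rule lift_exists)
  then have nS: "n \<in> SL3" by (simp add: is_lift_def)
  define b where "b = matrix_inv n ** g ** n"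
  have "n ** b ** matrix_inv n = (n ** matrix_inv n) ** g ** (n ** matrix_inv n)"
    by (simp add: b_def matrix_mul_assoc)
  then have g: "g = n ** b ** matrix_inv n" by (simp add: SL3_inv nS)
  have "det b = det (matrix_inv n ** n) * det g" by (simp add: b_def det_mul)
  then have "b \<in> SL3" using assms by (simp add: SL3_inv[OF nS] SL3_def)
  with n g show thesis using that by blast
qed

lemma conj_SL3:
  fixes n b :: "'k::field ^ 3 ^ 3"
  assumes "is_lift w n" "b \<in> SL3"
  shows "n ** b ** matrix_inv n \<in> SL3"
proof -
  have nS: "n \<in> SL3" using assms by (simp add: is_lift_def)
  have "det (n ** b ** matrix_inv n) = det (n ** matrix_inv n) * det b" by (simp add: det_mul)
  then show ?thesis using assms by (simp add: SL3_inv[OF nS] SL3_def)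
qed

lemma lift_nonzero: "is_lift w n \<Longrightarrow> n $ (w \<langle>$\<rangle> i) $ i \<noteq> 0"
  by (simp add: is_lift_def)

lemma borel_at_iff:
  fixes g :: "'k::field ^ 3 ^ 3"
  shows "g \<in> borel_at w \<longleftrightarrow> g \<in> SL3 \<and> g $ (w \<langle>$\<rangle> 2) $ (w \<langle>$\<rangle> 1) = 0 \<and>
    g $ (w \<langle>$\<rangle> 3) $ (w \<langle>$\<rangle> 1) = 0 \<and> g $ (w \<langle>$\<rangle> 3) $ (w \<langle>$\<rangle> 2) = 0" (is "_ \<longleftrightarrow> ?R")
proof
  assume "g \<in> borel_at w"
  then show ?R by (auto simp: borel_at_def borel_e_def conj_entry conj_SL3)
next
  assume R: ?R
  then obtain n b where nb: "is_lift w n" "b \<in> SL3" "g = n ** b ** matrix_inv n"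
    using conj_obtain by blast
  then have "b \<in> borel_e" using R lift_nonzero[OF nb(1)] by (simp add: borel_e_def conj_entry)
  with nb show "g \<in> borel_at w" unfolding borel_at_def by blast
qed

lemma unip_at_iff:
  fixes g :: "'k::field ^ 3 ^ 3"
  shows "g \<in> unip_at w \<longleftrightarrow> g \<in> borel_at w \<and> (\<forall>i. g $ i $ i = 1)" (is "_ \<longleftrightarrow> ?R")
proof
  assume "g \<in> unip_at w"
  then obtain n b where nb: "is_lift w n" "b \<in> unip_e" "g = n ** b ** matrix_inv n"
    by (auto simp: unip_at_def)
  have "g $ (w \<langle>$\<rangle> i) $ (w \<langle>$\<rangle> i) = 1" for i
    using nb lift_nonzero[OF nb(1)] by (simp add: conj_entry unip_e_def)
  then have "\<forall>i. g $ i $ i = 1" using perm3_exhaust[of _ w] by metis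
  moreover have "g \<in> borel_at w" using nb by (auto simp: borel_at_def unip_e_def)
  ultimately show ?R by blast
next
  assume R: ?R
  then obtain n b where nb: "is_lift w n" "b \<in> borel_e" "g = n ** b ** matrix_inv n"
    by (auto simp: borel_at_def)
  have "g $ (w \<langle>$\<rangle> i) $ (w \<langle>$\<rangle> i) = b $ i $ i" for i
    using nb lift_nonzero[OF nb(1)] by (simp add: conj_entry)
  then have "b \<in> unip_e" using R nb by (simp add: unip_e_def)
  with nb show "g \<in> unip_at w" unfolding unip_at_def by blast
qed

lemma pos_coroots_borel_at:
  "pos_coroots (borel_at w :: ('k::field ^ 3 ^ 3) set) =
     {(w \<langle>$\<rangle> 1, w \<langle>$\<rangle> 2), (w \<langle>$\<rangle> 1, w \<langle>$\<rangle> 3), (w \<langle>$\<rangle> 2, w \<langle>$\<rangle> 3)}"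
proof -
  have det: "root_elt i j c \<in> SL3" if "i \<noteq> j" for i j and c :: 'k
    using that exhaust_3[of i] exhaust_3[of j] by (auto simp: SL3_def det_3 root_elt_def)
  have mem: "(w \<langle>$\<rangle> i, w \<langle>$\<rangle> j) \<in> pos_coroots (borel_at w :: ('k ^ 3 ^ 3) set) \<longleftrightarrow>
      (i, j) \<in> {(1, 2), (1, 3), (2, 3)}" for i j
  proof (cases "i = j")
    case False
    have "(\<forall>c::'k. root_elt (w \<langle>$\<rangle> i) (w \<langle>$\<rangle> j) c \<in> borel_at w) \<longleftrightarrow>
        (i, j) \<noteq> (2, 1) \<and> (i, j) \<noteq> (3, 1) \<and> (i, j) \<noteq> (3, 2)"
      using False
      by (auto simp: borel_at_iff perm3_distinct det) (auto simp: root_elt_def perm3_distinct dest: spec[where x = 1])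
    then show ?thesis
      using False exhaust_3[of i] exhaust_3[of j] by (auto simp: pos_coroots_def perm3_distinct)
  qed (auto simp: pos_coroots_def)
  have "p \<in> pos_coroots (borel_at w :: ('k ^ 3 ^ 3) set) \<longleftrightarrow>
      p \<in> {(w \<langle>$\<rangle> 1, w \<langle>$\<rangle> 2), (w \<langle>$\<rangle> 1, w \<langle>$\<rangle> 3), (w \<langle>$\<rangle> 2, w \<langle>$\<rangle> 3)}" for p
  proof -
    obtain i j where "p = (w \<langle>$\<rangle> i, w \<langle>$\<rangle> j)"
      using perm3_exhaust[of "fst p" w] perm3_exhaust[of "snd p" w] by (metis prod.collapse)
    then show ?thesis using mem[of i j] by (simp add: perm3_distinct)
  qed
  then show ?thesis by blast
qed

lemma inj_borel_at: "inj (borel_at :: 3 perm \<Rightarrow> ('k::field ^ 3 ^ 3) set)"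
proof (rule injI)
  fix w w' :: "3 perm"
  assume "(borel_at w :: ('k ^ 3 ^ 3) set) = borel_at w'"
  then have eq: "{(w \<langle>$\<rangle> 1, w \<langle>$\<rangle> 2), (w \<langle>$\<rangle> 1, w \<langle>$\<rangle> 3), (w \<langle>$\<rangle> 2, w \<langle>$\<rangle> 3)} =
      {(w' \<langle>$\<rangle> 1, w' \<langle>$\<rangle> 2), (w' \<langle>$\<rangle> 1, w' \<langle>$\<rangle> 3), (w' \<langle>$\<rangle> 2, w' \<langle>$\<rangle> 3)}"
      (is "?A = ?A'")
    using pos_coroots_borel_at[where 'k = 'k] by metis
  have least: "a = u \<langle>$\<rangle> 1" if "\<forall>b. (b, a) \<notin> {(u \<langle>$\<rangle> 1, u \<langle>$\<rangle> 2), (u \<langle>$\<rangle> 1, u \<langle>$\<rangle> 3), (u \<langle>$\<rangle> 2, u \<langle>$\<rangle> 3)}"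
    for u :: "3 perm" and a
  proof -
    obtain k where "a = u \<langle>$\<rangle> k" by (rule perm3_exhaust)
    then show ?thesis using that exhaust_3[of k] by auto
  qed
  have greatest: "a = u \<langle>$\<rangle> 3" if "\<forall>b. (a, b) \<notin> {(u \<langle>$\<rangle> 1, u \<langle>$\<rangle> 2), (u \<langle>$\<rangle> 1, u \<langle>$\<rangle> 3), (u \<langle>$\<rangle> 2, u \<langle>$\<rangle> 3)}"
    for u :: "3 perm" and a
  proof -
    obtain k where "a = u \<langle>$\<rangle> k" by (rule perm3_exhaust)
    then show ?thesis using that exhaust_3[of k] by auto
  qed
  have "\<forall>b. (b, w \<langle>$\<rangle> 1) \<notin> ?A" by (simp add: perm3_distinct)
  then have 1: "w \<langle>$\<rangle> 1 = w' \<langle>$\<rangle> 1" unfolding eq by (rule least)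
  have "\<forall>b. (w \<langle>$\<rangle> 3, b) \<notin> ?A" by (simp add: perm3_distinct)
  then have 3: "w \<langle>$\<rangle> 3 = w' \<langle>$\<rangle> 3" unfolding eq by (rule greatest)
  obtain k where k: "w \<langle>$\<rangle> 2 = w' \<langle>$\<rangle> k" by (rule perm3_exhaust)
  have "k \<noteq> 1" "k \<noteq> 3" using k 1 3 perm3_distinct[of w 2 1] perm3_distinct[of w 2 3] by auto
  then have "w \<langle>$\<rangle> 2 = w' \<langle>$\<rangle> 2" using k exhaust_3[of k] by auto
  then have "\<forall>i. w \<langle>$\<rangle> i = w' \<langle>$\<rangle> i" using 1 3 by (simp add: forall_3)
  then show "w = w'" by (simp add: perm_eq_iff)
qed

lemma unip_at_iff_fixes:
  fixes u :: "'k::field ^ 3 ^ 3"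
  shows "u \<in> unip_at w \<longleftrightarrow> u \<in> SL3 \<and>
    (\<forall>i. u $ i $ (w \<langle>$\<rangle> 1) = (if i = w \<langle>$\<rangle> 1 then 1 else 0)) \<and>
    (\<forall>j. u $ (w \<langle>$\<rangle> 3) $ j = (if j = w \<langle>$\<rangle> 3 then 1 else 0))" (is "_ \<longleftrightarrow> ?R")
proof
  assume u: "u \<in> unip_at w"
  have "u $ (w \<langle>$\<rangle> k) $ (w \<langle>$\<rangle> 1) = (if k = 1 then 1 else 0)" for k
    using u exhaust_3[of k] by (auto simp: unip_at_iff borel_at_iff)
  then have "\<forall>i. u $ i $ (w \<langle>$\<rangle> 1) = (if i = w \<langle>$\<rangle> 1 then 1 else 0)"
    by (metis perm3_exhaust)
  moreover have "u $ (w \<langle>$\<rangle> 3) $ (w \<langle>$\<rangle> k) = (if k = 3 then 1 else 0)" for k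
    using u exhaust_3[of k] by (auto simp: unip_at_iff borel_at_iff)
  then have "\<forall>j. u $ (w \<langle>$\<rangle> 3) $ j = (if j = w \<langle>$\<rangle> 3 then 1 else 0)"
    by (metis perm3_exhaust)
  ultimately show ?R using u by (simp add: unip_at_iff borel_at_iff)
next
  assume R: ?R
  then obtain n b where nb: "is_lift w n" "b \<in> SL3" "u = n ** b ** matrix_inv n"
    using conj_obtain by blast
  have diag: "u $ (w \<langle>$\<rangle> i) $ (w \<langle>$\<rangle> i) = b $ i $ i" for i
    using lift_nonzero[OF nb(1)] by (simp add: nb(3) conj_entry[OF nb(1)])
  have zero: "b $ i $ j = 0 \<longleftrightarrow> u $ (w \<langle>$\<rangle> i) $ (w \<langle>$\<rangle> j) = 0" for i j
    using lift_nonzero[OF nb(1)] by (simp add: nb(3) conj_entry[OF nb(1)])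
  have b: "b $ 1 $ 1 = 1" "b $ 3 $ 3 = 1" "b $ 2 $ 1 = 0" "b $ 3 $ 1 = 0" "b $ 3 $ 2 = 0"
    using R by (simp_all add: zero diag[symmetric] perm3_distinct)
  then have b2: "b $ 2 $ 2 = 1" using nb(2) by (simp add: SL3_def det_3)
  from b b2 nb(2) have "b \<in> unip_e" by (simp add: unip_e_def borel_e_def forall_3)
  with nb show "u \<in> unip_at w" unfolding unip_at_def by blast
qed

lemma model_eq_iff:
  fixes g g' :: "'k::field ^ 3 ^ 3"
  assumes "g \<in> SL3" "g' \<in> SL3"
  shows "model w g = model w g' \<longleftrightarrow> matrix_inv g ** g' \<in> unip_at w"
proof -
  define u where "u = matrix_inv g ** g'"
  have gu: "g ** u = g'" by (simp add: u_def matrix_mul_assoc SL3_inv assms)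
  have "u ** matrix_inv g' = matrix_inv g ** (g' ** matrix_inv g')"
    by (simp add: u_def matrix_mul_assoc)
  then have ug: "u ** matrix_inv g' = matrix_inv g" by (simp add: SL3_inv assms)
  have "det g * det u = det g'" by (simp flip: gu add: det_mul)
  then have uS: "u \<in> SL3" using assms by (simp add: SL3_def)
  have "column a g = column a g' \<longleftrightarrow> column a u = axis a 1" for a
  proof -
    have "column a g = g *v axis a 1" 
      by (simp add: vec_eq_iff column_def matrix_vector_mult_def axis_def if_distrib cong: if_cong)
    moreover have "column a g' = g *v column a u"
      by (simp flip: gu add: vec_eq_iff column_def matrix_matrix_mult_def matrix_vector_mult_def)
    moreover have "g *v x = g *v y \<Longrightarrow> x = y" for x y
      by (metis SL3_inv(2) assms(1) matrix_vector_mul_assoc matrix_vector_mul_lid)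
    ultimately show ?thesis by metis
  qed
  then have 1: "column a g = column a g' \<longleftrightarrow> (\<forall>i. u $ i $ a = (if i = a then 1 else 0))" for a
    by (simp add: vec_eq_iff column_def axis_def)
  have "row a (matrix_inv g) = row a (matrix_inv g') \<longleftrightarrow> row a u = axis a 1" for a
  proof -
    have "row a (matrix_inv g') = axis a 1 v* matrix_inv g'"
      by (simp add: vec_eq_iff row_def vector_matrix_mult_def axis_def if_distrib if_distribR
          cong: if_cong)
    moreover have "row a (matrix_inv g) = row a u v* matrix_inv g'"
      by (simp flip: ug add: vec_eq_iff row_def matrix_matrix_mult_def vector_matrix_mult_def
          mult.commute)
    moreover have "x v* matrix_inv g' = y v* matrix_inv g' \<Longrightarrow> x = y" for x y
      by (metis SL3_inv(2) assms(2) vector_matrix_mul_assoc vector_matrix_mul_rid)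
    ultimately show ?thesis by metis
  qed
  then have 2: "row a (matrix_inv g) = row a (matrix_inv g') \<longleftrightarrow>
      (\<forall>j. u $ a $ j = (if j = a then 1 else 0))" for a
    by (simp add: vec_eq_iff row_def axis_def)
  show ?thesis using uS by (simp add: model_def 1 2 unip_at_iff_fixes flip: u_def)
qed

end

theory Submission
  imports Defs
begin

text \<open>
  In the models the three averaging conditions on \<open>f\<close> read \<open>\<Sum>t. f (t v, y) = 0\<close>, \<open>\<Sum>t. f (v, t y) = 0\<close>
  and \<open>\<Sum>t. f (t v, t y) = 0\<close> for every \<open>w\<close>, so all the spaces \<open>S' w\<close> coincide, and their elements
  vanish where \<open>v = 0\<close> or \<open>y = 0\<close>. For \<open>y \<noteq> 0\<close> the transform \<open>BK12\<close> is the symplectic Fourier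
  transform on the plane orthogonal to \<open>y\<close>, whence \<open>BK12\<^sup>2 = q\<^sup>2\<close>; \<open>BK23\<close> is its conjugate under the
  exchange of \<open>v\<close> and \<open>y\<close>.

  The kernel of \<open>BK12 BK23 BK12\<close> from \<open>(p, z)\<close> to \<open>(v, y)\<close> is a sum over the nonzero \<open>u\<close> orthogonal
  to \<open>y\<close> and \<open>z\<close>. If \<open>y\<close> and \<open>z\<close> are independent, then \<open>u = c (y \<times> z)\<close> and the sum is exactly
  \<open>Kl (\<langle>p, y\<rangle> + \<langle>v, z\<rangle>)\<close>. If \<open>z = l y\<close>, it exceeds \<open>Kl 0 = - 1\<close> by \<open>q\<^sup>2\<close> when \<open>p = l v\<close> and by \<open>0\<close>
  otherwise, and the excess is killed by the third averaging condition. The Kloosterman kernel is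
  symmetric under the exchange, so the braid relation holds and the normalized transforms define a
  right action of \<open>S\<^sub>3\<close>; the operator from \<open>w\<close> to \<open>w'\<close> is the action of \<open>w\<inverse> w'\<close>.
\<close>

subsection \<open>Cross products over a field\<close>

lemma scalar_product_3:
  fixes u v :: "'k::field ^ 3"
  shows "scalar_product u v = u $ 1 * v $ 1 + u $ 2 * v $ 2 + u $ 3 * v $ 3"
  by (simp add: scalar_product_def sum_3)

lemma cross_nth [simp]:
  "cross a b $ 1 = a $ 2 * b $ 3 - a $ 3 * b $ 2"
  "cross a b $ 2 = a $ 3 * b $ 1 - a $ 1 * b $ 3"
  "cross a b $ 3 = a $ 1 * b $ 2 - a $ 2 * b $ 1"
  by (simp_all add: cross_def)

lemmas vec3_simps = vec_eq_iff forall_3 scalar_product_3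

lemma scalar_product_commute: "scalar_product (u :: 'k::field ^ 3) v = scalar_product v u"
  by (simp add: vec3_simps mult.commute)

lemma scalar_product_simps [simp]:
  fixes u v w :: "'k::field ^ 3"
  shows "scalar_product (c *s u) v = c * scalar_product u v"
    "scalar_product u (c *s v) = c * scalar_product u v"
    "scalar_product (u + w) v = scalar_product u v + scalar_product w v"
    "scalar_product (u - w) v = scalar_product u v - scalar_product w v"
    "scalar_product 0 v = 0" "scalar_product u 0 = 0"
  by (simp_all add: scalar_product_3 algebra_simps)

lemma scalar_product_add_right [simp]:
  fixes u v w :: "'k::field ^ 3"
  shows "scalar_product v (u + w) = scalar_product v u + scalar_product v w"
    "scalar_product v (u - w) = scalar_product v u - scalar_product v w"
  by (simp_all add: scalar_product_3 algebra_simps)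

lemma cross_simps [simp]:
  fixes a b :: "'k::field ^ 3"
  shows "cross (c *s a) b = c *s cross a b" "cross a (c *s b) = c *s cross a b"
    "cross 0 b = 0" "cross a 0 = 0" "cross a a = 0"
  by (simp_all add: vec3_simps algebra_simps)

lemma cross_add:
  fixes a b :: "'k::field ^ 3"
  shows "cross (a + a') b = cross a b + cross a' b" "cross a (b + b') = cross a b + cross a b'"
    "cross (a - a') b = cross a b - cross a' b" "cross a (b - b') = cross a b - cross a b'"
  by (simp_all add: vec3_simps algebra_simps)

lemma cross_anticommute: "cross (a :: 'k::field ^ 3) b = - cross b a"
  by (simp add: vec3_simps)

lemma cross_cross_left:
  fixes a b c :: "'k::field ^ 3"
  shows "cross (cross a b) c = scalar_product a c *s b - scalar_product b c *s a"
  by (simp add: vec3_simps algebra_simps)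

lemma cross_cross_right:
  fixes a b c :: "'k::field ^ 3"
  shows "cross a (cross b c) = scalar_product a c *s b - scalar_product a b *s c"
  by (simp add: vec3_simps algebra_simps)

lemma scalar_product_cross [simp]:
  fixes a b :: "'k::field ^ 3"
  shows "scalar_product (cross a b) a = 0" "scalar_product (cross a b) b = 0"
  by (simp_all add: vec3_simps algebra_simps)

section \<open>The cross quotient as a symplectic form on a plane\<close>

lemma cross_eq_0_imp_multiple:
  fixes a c :: "'k::field ^ 3"
  assumes "cross a c = 0" "c \<noteq> 0"
  obtains m where "a = m *s c"
proof -
  obtain i where i: "c $ i \<noteq> 0" using assms(2) by (auto simp: vec_eq_iff)
  \<comment> \<open>The components of the cross product are the 2 by 2 minors of the pair.\<close>
  have "a $ j * c $ l = a $ l * c $ j" for j l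
    using assms(1) exhaust_3[of j] exhaust_3[of l] by (auto simp: vec3_simps mult.commute)
  then have "a = (a $ i / c $ i) *s c" using i by (simp add: vec_eq_iff field_simps)
  then show thesis by (rule that)
qed

lemma cross_quot_eqI:
  fixes a b c :: "'k::field ^ 3"
  assumes "cross a b = m *s c" "c \<noteq> 0"
  shows "cross_quot a b c = m"
  unfolding cross_quot_def
  by (rule the_equality) (use assms in \<open>auto simp: vector_mul_rcancel\<close>)

text \<open>The double cross product formula gives \<open>cross (cross a b) c = 0\<close> for
  \<open>a\<close> and \<open>b\<close> orthogonal to \<open>c\<close>, so the scalar described in
  \<open>cross_quot\<close> exists.\<close>

lemma cross_eq_cross_quot:
  fixes a b c :: "'k::field ^ 3"
  assumes "scalar_product a c = 0" "scalar_product b c = 0" "c \<noteq> 0"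
  shows "cross a b = cross_quot a b c *s c"
proof -
  have "cross (cross a b) c = 0" using assms by (simp add: cross_cross_left)
  then obtain m where m: "cross a b = m *s c" using assms(3) by (rule cross_eq_0_imp_multiple)
  then show ?thesis using cross_quot_eqI[OF m assms(3)] by simp
qed

lemma cross_quot_linear:
  fixes a b c :: "'k::field ^ 3"
  assumes "scalar_product a c = 0" "scalar_product b c = 0" "scalar_product a' c = 0" "c \<noteq> 0"
  shows "cross_quot (a + a') b c = cross_quot a b c + cross_quot a' b c"
    "cross_quot (a - a') b c = cross_quot a b c - cross_quot a' b c"
    "cross_quot (r *s a) b c = r * cross_quot a b c"
    "cross_quot b a c = - cross_quot a b c"
  using cross_eq_cross_quot[of a c b] cross_eq_cross_quot[of a' c b] assms
  by (auto intro!: cross_quot_eqI simp: cross_add vector_sub_rdistrib vector_sadd_rdistrib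
      vector_smult_assoc cross_anticommute[of b a])

lemma cross_quot_nondegenerate:
  fixes x y :: "'k::field ^ 3"
  assumes "scalar_product x y = 0" "x \<noteq> 0" "y \<noteq> 0"
  obtains u where "scalar_product u y = 0" "cross_quot u x y \<noteq> 0"
proof -
  obtain i where i: "x $ i \<noteq> 0" using assms(2) by (auto simp: vec_eq_iff)
  have "scalar_product (axis i 1) x = x $ i"
    using exhaust_3[of i] by (auto simp: scalar_product_3 axis_def)
  \<comment> \<open>The witness is the product of \<open>y\<close> with a basis vector that pairs
    nontrivially with \<open>x\<close>: as \<open>x\<close> and \<open>y\<close> are orthogonal, its
    product with \<open>x\<close> is a nonzero multiple of \<open>y\<close>.\<close>
  then have "cross (cross y (axis i 1)) x = (- (x $ i)) *s y"
    using assms(1) by (simp add: cross_cross_left scalar_product_commute[of y x])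
  from cross_quot_eqI[OF this assms(3)] i show thesis
    by (intro that[of "cross y (axis i 1)"]) simp_all
qed

subsection \<open>Functions on the quadric and the symmetries of the transforms\<close>

text \<open>In every model the right action of the torus on functions is such a dilation, see
  \<open>act_fun_eq\<close>.\<close>

definition dilate :: "'k \<Rightarrow> 'k \<Rightarrow> ('k::field pt \<Rightarrow> complex) \<Rightarrow> 'k pt \<Rightarrow> complex" where
  "dilate a b f = (\<lambda>(v, y). f (a *s v, b *s y))"

text \<open>Exchange of vectors and covectors; it carries the action of \<open>g\<close> to that of
  its inverse transpose.\<close>

definition flip :: "('k::field pt \<Rightarrow> complex) \<Rightarrow> 'k pt \<Rightarrow> complex" where
  "flip f = (\<lambda>(v, y). f (y, v))"

text \<open>The averages are asked for at all pairs, which saves side conditions: off the quadric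
  they vanish termwise by the support condition.\<close>

definition zero_avg :: "('k::{field,finite} pt \<Rightarrow> complex) set" where
  "zero_avg = {f. (\<forall>v y. scalar_product v y \<noteq> 0 \<longrightarrow> f (v, y) = 0) \<and>
     (\<forall>v y. (\<Sum>t\<in>UNIV - {0}. f (t *s v, y)) = 0 \<and> (\<Sum>t\<in>UNIV - {0}. f (v, t *s y)) = 0 \<and>
        (\<Sum>t\<in>UNIV - {0}. f (t *s v, t *s y)) = 0)}"

text \<open>The action on the model involves only the diagonal entries at the images of 1 and 3
  under \<open>w\<close>, and the positive coroots are indexed by images under \<open>w\<close> as
  well; the two dependences on \<open>w\<close> cancel.\<close>

lemma S'_eq_zero_avg: "S' w = (zero_avg :: ('k::{field,finite} pt \<Rightarrow> complex) set)"
proof -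
  have *: "right_act w (v, y) (coroot (w \<langle>$\<rangle> 1) (w \<langle>$\<rangle> 2) t) = (t *s v, y)"
    "right_act w (v, y) (coroot (w \<langle>$\<rangle> 1) (w \<langle>$\<rangle> 3) t) = (t *s v, t *s y)"
    "right_act w (v, y) (coroot (w \<langle>$\<rangle> 2) (w \<langle>$\<rangle> 3) t) = (v, t *s y)" for v y and t :: 'k
    by (auto simp: right_act_def coroot_def perm3_distinct)
  define avg0 :: "('k pt \<Rightarrow> complex) \<Rightarrow> 'k ^ 3 \<Rightarrow> 'k ^ 3 \<Rightarrow> bool" where
    "avg0 f v y \<longleftrightarrow> (\<Sum>t\<in>UNIV - {0}. f (t *s v, y)) = 0 \<and>
      (\<Sum>t\<in>UNIV - {0}. f (v, t *s y)) = 0 \<and> (\<Sum>t\<in>UNIV - {0}. f (t *s v, t *s y)) = 0" for f v y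
  have S': "f \<in> S' w \<longleftrightarrow> (\<forall>v y. scalar_product v y \<noteq> 0 \<longrightarrow> f (v, y) = 0) \<and>
      (\<forall>v y. scalar_product v y = 0 \<longrightarrow> avg0 f v y)" for f
    unfolding S'_def pos_coroots_borel_at quadric_def avg0_def by (simp add: *) blast
  have "avg0 f v y" if "\<forall>v y. scalar_product v y \<noteq> 0 \<longrightarrow> f (v, y) = 0" "scalar_product v y \<noteq> 0"
    for f v y
    using that by (simp add: avg0_def)
  then have "f \<in> S' w \<longleftrightarrow> (\<forall>v y. scalar_product v y \<noteq> 0 \<longrightarrow> f (v, y) = 0) \<and> (\<forall>v y. avg0 f v y)" for f
    unfolding S' by blast
  then show ?thesis by (auto simp: zero_avg_def avg0_def)
qed

lemma zero_avgD:
  fixes f :: "'k::{field,finite} pt \<Rightarrow> complex"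
  assumes "f \<in> zero_avg"
  shows "scalar_product v y \<noteq> 0 \<Longrightarrow> f (v, y) = 0"
    "(\<Sum>t\<in>UNIV - {0}. f (t *s v, y)) = 0" "(\<Sum>t\<in>UNIV - {0}. f (v, t *s y)) = 0"
    "(\<Sum>t\<in>UNIV - {0}. f (t *s v, t *s y)) = 0"
  using assms by (auto simp: zero_avg_def)

lemma card_nonzero: "of_nat (card (UNIV - {0::'k::{field,finite}})) \<noteq> (0::complex)"
proof -
  have "(1::'k) \<in> UNIV - {0}" by simp
  then show ?thesis by (metis card_eq_0_iff empty_iff finite of_nat_eq_0_iff)
qed

lemma zero_avg_0:
  fixes f :: "'k::{field,finite} pt \<Rightarrow> complex"
  assumes "f \<in> zero_avg"
  shows "f (0, y) = 0" "f (v, 0) = 0"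
proof -
  \<comment> \<open>Scaling fixes a zero component, so the average is \<open>q - 1\<close> times a
    single value.\<close>
  have "of_nat (card (UNIV - {0::'k})) * f (0, y) = 0" "of_nat (card (UNIV - {0::'k})) * f (v, 0) = 0"
    using zero_avgD(2)[OF assms, of 0 y] zero_avgD(3)[OF assms, of v 0]
    unfolding sum_constant[symmetric] by (simp_all del: sum_constant)
  then show "f (0, y) = 0" "f (v, 0) = 0" using card_nonzero[where 'k='k] by (auto simp del: of_nat_eq_0_iff)
qed

lemma zero_avg_lincomb:
  assumes "f \<in> zero_avg" "g \<in> zero_avg"
  shows "(\<lambda>x. f x + g x) \<in> zero_avg" "(\<lambda>x. c * f x) \<in> zero_avg" "(\<lambda>x. f x / c) \<in> zero_avg"
  using assms by (auto simp: zero_avg_def sum.distrib simp flip: sum_distrib_left sum_divide_distrib)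

lemma flip_apply: "flip f (v, y) = f (y, v)"
  by (simp add: flip_def)

lemma flip_flip [simp]: "flip (flip f) = f"
  by (auto simp: flip_def)

lemma flip_zero_avg: "f \<in> zero_avg \<Longrightarrow> flip f \<in> zero_avg"
  by (auto simp: zero_avg_def flip_def scalar_product_commute)

text \<open>In both formulas the summed variable comes first in the cross product, so the exchange
  introduces no sign.\<close>

lemma BK23_flip: "BK23 \<psi> f = flip (BK12 \<psi> (flip f))"
  by (auto simp: BK23_def BK12_def flip_def fun_eq_iff quadric_def scalar_product_commute)

lemma mem_quadric: "(v, y) \<in> quadric \<longleftrightarrow> scalar_product v y = 0"
  by (simp add: quadric_def)

lemma Kl_transform_flip: "Kl_transform \<psi> (flip f) = flip (Kl_transform \<psi> f)"
proof (rule ext, clarify)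
  fix v y :: "'a ^ 3"
  have comm: "scalar_product z y + scalar_product v u = scalar_product u v + scalar_product y z"
    for u z
    by (simp only: scalar_product_commute[of z y] scalar_product_commute[of v u] add.commute)
  have "(\<Sum>(u, z)\<in>quadric. f (z, u) * Kl \<psi> (scalar_product u y + scalar_product v z))
      = (\<Sum>(u, z)\<in>quadric. f (u, z) * Kl \<psi> (scalar_product u v + scalar_product y z))"
    by (rule sum.reindex_bij_witness[of _ prod.swap prod.swap])
      (auto simp: mem_quadric comm, simp_all add: scalar_product_commute)
  then show "Kl_transform \<psi> (flip f) (v, y) = flip (Kl_transform \<psi> f) (v, y)"
    by (simp add: Kl_transform_def flip_apply mem_quadric scalar_product_commute[of v y])
qed

section \<open>Linearity of \<open>BK12\<close> and its behaviour under dilations and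
  \<open>SL3\<close>\<close>

lemma BK12_lincomb:
  "BK12 \<psi> (\<lambda>x. f x + g x) = (\<lambda>x. BK12 \<psi> f x + BK12 \<psi> g x)"
  "BK12 \<psi> (\<lambda>x. c * f x) = (\<lambda>x. c * BK12 \<psi> f x)"
  "BK12 \<psi> (\<lambda>x. f x / c) = (\<lambda>x. BK12 \<psi> f x / c)"
  by (auto simp: BK12_def fun_eq_iff algebra_simps sum.distrib sum_distrib_left sum_divide_distrib)

lemma BK12_sum:
  assumes "finite T"
  shows "BK12 \<psi> (\<lambda>x. \<Sum>t\<in>T. h t x) = (\<lambda>x. \<Sum>t\<in>T. BK12 \<psi> (h t) x)"
  using assms
proof (induction T rule: finite_induct)
  case empty
  then show ?case by (auto simp: BK12_def fun_eq_iff)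
next
  case (insert t T)
  then show ?case by (simp add: BK12_lincomb)
qed

text \<open>Scaling \<open>v\<close> by \<open>a\<close> and \<open>y\<close> by \<open>b\<close>
  multiplies the quotient by \<open>a / b\<close>; substituting \<open>(b / a) *s u\<close> for
  \<open>u\<close> absorbs this factor.\<close>

lemma dilate_BK12:
  fixes a b :: "'k::{field,finite}"
  assumes "a \<noteq> 0" "b \<noteq> 0"
  shows "dilate a b (BK12 \<psi> f) = BK12 \<psi> (dilate (b / a) b f)"
proof (rule ext, clarify)
  fix v y :: "'k ^ 3"
  show "dilate a b (BK12 \<psi> f) (v, y) = BK12 \<psi> (dilate (b / a) b f) (v, y)"
  proof (cases "scalar_product v y = 0 \<and> y \<noteq> 0")
    case True
    have quot: "cross_quot ((b / a) *s u) (a *s v) (b *s y) = cross_quot u v y"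
      if "scalar_product u y = 0" for u
      using cross_eq_cross_quot[of u y v] that True assms
      by (intro cross_quot_eqI) (simp_all add: vector_smult_assoc mult.commute)
    then have "(\<Sum>u | scalar_product u (b *s y) = 0. f (u, b *s y) * \<psi> (cross_quot u (a *s v) (b *s y)))
      = (\<Sum>u | scalar_product u y = 0. f ((b / a) *s u, b *s y) * \<psi> (cross_quot u v y))"
      using assms
      by (intro sum.reindex_bij_witness[of _ "\<lambda>u. (b / a) *s u" "\<lambda>u. (a / b) *s u"])
        (use assms in \<open>auto simp: vector_smult_assoc simp flip: quot\<close>)
    then show ?thesis using True assms by (simp add: dilate_def BK12_def quadric_def)
  qed (use assms in \<open>auto simp: dilate_def BK12_def quadric_def\<close>)
qed

text \<open>By \<open>dilate_BK12\<close> the transform permutes the averages as the reflection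
  permutes coroots: the average along \<open>(t, 1)\<close> goes to the one along
  \<open>(1 / t, 1)\<close>, and those along \<open>(1, t)\<close> and \<open>(t, t)\<close> are
  exchanged.\<close>

lemma BK12_zero_avg:
  fixes f :: "'k::{field,finite} pt \<Rightarrow> complex"
  assumes "f \<in> zero_avg"
  shows "BK12 \<psi> f \<in> zero_avg"
proof -
  have zero: "(\<Sum>t\<in>T. BK12 \<psi> (h t) x) = 0" if "\<And>x. (\<Sum>t\<in>T. h t x) = 0" for T :: "'k set" and h x
  proof -
    have "(\<Sum>t\<in>T. BK12 \<psi> (h t) x) = BK12 \<psi> (\<lambda>x. \<Sum>t\<in>T. h t x) x" by (simp add: BK12_sum)
    also have "\<dots> = 0" by (simp add: that BK12_def case_prod_unfold)
    finally show ?thesis .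
  qed
  have rewr: "(\<Sum>t\<in>UNIV - {0}. BK12 \<psi> f (a t *s v, b t *s y)) =
      (\<Sum>t\<in>UNIV - {0}. BK12 \<psi> (dilate (b t / a t) (b t) f) (v, y))"
    if "\<And>t. t \<noteq> 0 \<Longrightarrow> a t \<noteq> 0 \<and> b t \<noteq> 0" for a b :: "'k \<Rightarrow> 'k" and v y
    using that by (intro sum.cong refl) (simp flip: dilate_BK12, simp add: dilate_def)
  have inv: "(\<Sum>t\<in>UNIV - {0}. f ((1 / t) *s v, y)) = (\<Sum>t\<in>UNIV - {0}. f (t *s v, y))" for v y
    by (rule sum.reindex_bij_witness[of _ inverse inverse]) (auto simp: field_simps)
  have scaled: "(\<Sum>t\<in>UNIV - {0}. dilate (1 / t) 1 f x) = 0" "(\<Sum>t\<in>UNIV - {0}. dilate (t / t) t f x) = 0"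
      "(\<Sum>t\<in>UNIV - {0}. dilate (t / 1) t f x) = 0" for x
    using zero_avgD[OF assms] inv by (cases x; simp add: dilate_def)+
  show ?thesis
    unfolding zero_avg_def
    using zero[OF scaled(1)] zero[OF scaled(2)] zero[OF scaled(3)]
      rewr[of "\<lambda>t. t" "\<lambda>t. 1"] rewr[of "\<lambda>t. 1" "\<lambda>t. t"] rewr[of "\<lambda>t. t" "\<lambda>t. t"]
    by (auto simp: BK12_def quadric_def)
qed

text \<open>After multiplication by \<open>g\<close> on the right this is the cofactor identity,
  with factor \<open>det g = 1\<close>.\<close>

lemma cross_matrix:
  fixes g :: "'k::field ^ 3 ^ 3"
  assumes "g \<in> SL3"
  shows "cross (g *v u) (g *v v) = cross u v v* matrix_inv g"
proof -
  have "cross (g *v u) (g *v v) v* g = det g *s cross u v"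
    by (simp add: vec3_simps vector_matrix_mult_def matrix_vector_mult_def sum_3 det_3 algebra_simps)
  then have "cross (g *v u) (g *v v) v* g v* matrix_inv g = cross u v v* matrix_inv g"
    using assms by (simp add: SL3_def)
  then show ?thesis using SL3_inv[OF assms] by (simp add: vector_matrix_mul_assoc)
qed

lemma scalar_product_matrix:
  fixes g :: "'k::field ^ 3 ^ 3"
  shows "scalar_product (g *v u) y = scalar_product u (y v* g)"
  by (simp add: vec3_simps vector_matrix_mult_def matrix_vector_mult_def sum_3 algebra_simps)

text \<open>By \<open>cross_matrix\<close>, \<open>g\<close> maps the plane orthogonal to
  \<open>y\<close> onto the one orthogonal to the transformed covector and preserves the cross
  quotient, so \<open>u\<close> can be replaced by \<open>g *v u\<close>.\<close>

lemma BK12_left_act: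
  fixes g :: "'k::{field,finite} ^ 3 ^ 3"
  assumes g: "g \<in> SL3"
  shows "BK12 \<psi> (f \<circ> left_act g) = BK12 \<psi> f \<circ> left_act g"
proof (rule ext, clarify)
  fix v y :: "'k ^ 3"
  let ?h = "matrix_inv g"
  have gh: "?h *v (g *v u) = u" "g *v (?h *v u) = u" "(y v* ?h) v* g = y" for u y
    using SL3_inv[OF g] by (simp_all add: matrix_vector_mul_assoc vector_matrix_mul_assoc)
  have dot: "scalar_product (g *v u) (y v* ?h) = scalar_product u y" for u y
    by (simp add: scalar_product_matrix gh)
  have dot_inv: "scalar_product (?h *v u) y = scalar_product u (y v* ?h)" for u y
    by (simp add: scalar_product_matrix)
  have y0: "y v* ?h = 0 \<longleftrightarrow> y = 0"
    by (metis gh(3) vector_matrix_mult_0)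
  show "BK12 \<psi> (f \<circ> left_act g) (v, y) = (BK12 \<psi> f \<circ> left_act g) (v, y)"
  proof (cases "scalar_product v y = 0 \<and> y \<noteq> 0")
    case True
    have quot: "cross_quot (g *v u) (g *v v) (y v* ?h) = cross_quot u v y"
      if "scalar_product u y = 0" for u
      using cross_eq_cross_quot[of u y v] that True y0
      by (intro cross_quot_eqI) (simp_all add: cross_matrix[OF g] vector_matrix_mult_def vec_eq_iff sum_distrib_left algebra_simps)
    have quot': "cross_quot u (g *v v) (y v* ?h) = cross_quot (?h *v u) v y"
      if "scalar_product u (y v* ?h) = 0" for u
      using quot[of "?h *v u"] that by (simp add: gh dot_inv)
    have "(\<Sum>u | scalar_product u (y v* ?h) = 0. f (u, y v* ?h) * \<psi> (cross_quot u (g *v v) (y v* ?h)))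
      = (\<Sum>u | scalar_product u y = 0. f (g *v u, y v* ?h) * \<psi> (cross_quot u v y))"
      by (rule sum.reindex_bij_witness[of _ "\<lambda>u. g *v u" "\<lambda>u. ?h *v u"])
        (simp_all add: gh dot quot' dot_inv)
    then show ?thesis using True by (simp add: BK12_def quadric_def left_act_def dot y0)
  qed (auto simp: BK12_def quadric_def left_act_def dot y0)
qed

lemma SL3_matrix_inv:
  fixes g :: "'k::field ^ 3 ^ 3"
  assumes "g \<in> SL3"
  shows "matrix_inv g \<in> SL3"
proof -
  have "det g * det (matrix_inv g) = 1" using SL3_inv(1)[OF assms] by (metis det_mul det_I)
  then show ?thesis using assms by (simp add: SL3_def)
qed

text \<open>The witness is the inverse transpose of \<open>g\<close>. This transfers equivariance
  from \<open>BK12\<close> to \<open>BK23\<close>.\<close>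

lemma left_act_flip:
  fixes g :: "'k::field ^ 3 ^ 3"
  assumes g: "g \<in> SL3"
  obtains g' where "g' \<in> SL3" "\<And>f. flip (f \<circ> left_act g) = flip f \<circ> left_act g'"
    "\<And>f. flip (f \<circ> left_act g') = flip f \<circ> left_act g"
proof -
  let ?h = "matrix_inv g"
  let ?g = "transpose ?h"
  have "?g ** transpose g = mat 1" using SL3_inv[OF g] by (simp flip: matrix_transpose_mul)
  then have inv: "matrix_inv ?g = transpose g" by (rule matrix_inv_eqI)
  have "?g \<in> SL3" using SL3_matrix_inv[OF g] by (simp add: SL3_def)
  moreover have "?g *v y = y v* ?h" "v v* transpose g = g *v v" for v y
    by (simp_all add: vec_eq_iff matrix_vector_mult_def vector_matrix_mult_def transpose_def mult.commute)
  ultimately show thesis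
    by (intro that[of ?g]) (auto simp: fun_eq_iff flip_def left_act_def inv)
qed

subsection \<open>The square of a transform and the braid relation\<close>

text \<open>Sums over the whole space are easier to interchange. The added terms vanish by the
  support of \<open>f\<close>; at \<open>y = 0\<close> the quotient is unspecified, but its
  coefficients \<open>f (u, 0)\<close> are zero.\<close>

lemma BK12_apply:
  assumes "f \<in> zero_avg" "scalar_product v y = 0"
  shows "BK12 \<psi> f (v, y) = (\<Sum>u\<in>UNIV. f (u, y) * \<psi> (cross_quot u v y))"
proof (cases "y = 0")
  case True
  then show ?thesis using assms by (simp add: BK12_def zero_avg_0)
next
  case False
  have "(\<Sum>u | scalar_product u y = 0. f (u, y) * \<psi> (cross_quot u v y))
      = (\<Sum>u\<in>UNIV. f (u, y) * \<psi> (cross_quot u v y))"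
    by (rule sum.mono_neutral_left) (use assms in \<open>auto simp: zero_avgD\<close>)
  then show ?thesis using False assms by (simp add: BK12_def mem_quadric)
qed

lemma BK23_apply:
  assumes "f \<in> zero_avg" "scalar_product v y = 0"
  shows "BK23 \<psi> f (v, y) = (\<Sum>z\<in>UNIV. f (v, z) * \<psi> (cross_quot z y v))"
  using BK12_apply[OF flip_zero_avg[OF assms(1)], of y v] assms(2)
  by (simp add: BK23_flip flip_apply scalar_product_commute[of y v])

lemma BK23_zero_avg: "f \<in> zero_avg \<Longrightarrow> BK23 \<psi> f \<in> zero_avg"
  by (simp add: BK23_flip flip_zero_avg BK12_zero_avg)

text \<open>With the constant function 1 in place of the character, the sum is the value of
  \<open>BK12\<close> at \<open>(0, y)\<close>, and elements of \<open>zero_avg\<close> vanish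
  there.\<close>

lemma sum_zero_avg_fst:
  fixes f :: "'k::{field,finite} pt \<Rightarrow> complex"
  assumes "f \<in> zero_avg"
  shows "(\<Sum>u\<in>UNIV. f (u, y)) = 0"
proof (cases "y = 0")
  case False
  then have "cross_quot u 0 y = 0" for u by (intro cross_quot_eqI) simp_all
  then show ?thesis
    using BK12_apply[OF assms, of 0 y "\<lambda>_. 1"] zero_avg_0(1)[OF BK12_zero_avg[OF assms]] by simp
qed (use assms in \<open>simp add: zero_avg_0\<close>)

section \<open>Character sums and the square of a transform\<close>

context
  fixes \<psi> :: "'k::{field,finite} \<Rightarrow> complex"
  assumes \<psi>: "nontrivial_additive_character \<psi>"
begin

lemma psi_add: "\<psi> (x + y) = \<psi> x * \<psi> y"
  using \<psi> by (simp add: nontrivial_additive_character_def)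

lemma psi_0: "\<psi> 0 = 1"
proof -
  have "\<psi> 0 * \<psi> 0 = \<psi> 0 * 1" "\<psi> 0 \<noteq> 0"
    using \<psi> psi_add[of 0 0] by (simp_all add: nontrivial_additive_character_def)
  then show ?thesis by simp
qed

lemma psi_nontrivial:
  assumes "c \<noteq> 0"
  obtains r where "\<psi> (r * c) \<noteq> 1"
proof -
  obtain x where "\<psi> x \<noteq> 1" using \<psi> by (auto simp: nontrivial_additive_character_def)
  then show thesis using assms by (intro that[of "x / c"]) simp
qed

text \<open>Translation by \<open>w\<close> permutes \<open>S\<close> and multiplies the sum by
  \<open>\<psi> (h w)\<close>, which differs from 1. The set \<open>S\<close> will be the field, the
  whole space or a plane.\<close>

lemma character_sum_eq_0:
  fixes h :: "'v::ab_group_add \<Rightarrow> 'k"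
  assumes "\<And>u. u \<in> S \<Longrightarrow> u + w \<in> S \<and> u - w \<in> S"
    and "\<And>u. u \<in> S \<Longrightarrow> h (u + w) = h u + h w" and "\<psi> (h w) \<noteq> 1"
  shows "(\<Sum>u\<in>S. \<psi> (h u)) = 0"
proof -
  have "(\<Sum>u\<in>S. \<psi> (h u)) = (\<Sum>u\<in>S. \<psi> (h (u + w)))"
    by (rule sum.reindex_bij_witness[of _ "\<lambda>u. u + w" "\<lambda>u. u - w"]) (use assms(1) in auto)
  also have "\<dots> = (\<Sum>u\<in>S. \<psi> (h u)) * \<psi> (h w)"
    by (simp add: assms(2) psi_add sum_distrib_right)
  finally show ?thesis using assms(3) by simp
qed

lemma sum_psi_mult: "(\<Sum>t\<in>UNIV. \<psi> (t * c)) = (if c = 0 then of_nat CARD('k) else 0)"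
proof (cases "c = 0")
  case False
  then obtain r where "\<psi> (r * c) \<noteq> 1" by (rule psi_nontrivial)
  then have "(\<Sum>t\<in>UNIV. \<psi> (t * c)) = 0"
    by (intro character_sum_eq_0[where w = r]) (auto simp: algebra_simps)
  then show ?thesis using False by simp
qed (simp add: psi_0)

lemma sum_psi_scalar_product:
  fixes y :: "'k ^ 3"
  assumes "y \<noteq> 0"
  shows "(\<Sum>u\<in>UNIV. \<psi> (scalar_product u y)) = 0"
proof -
  obtain i where i: "y $ i \<noteq> 0" using assms by (auto simp: vec_eq_iff)
  then obtain r where r: "\<psi> (r * y $ i) \<noteq> 1" by (rule psi_nontrivial)
  have "scalar_product (r *s axis i 1) y = r * y $ i"
    using exhaust_3[of i] by (auto simp: scalar_product_3 axis_def)
  with r show ?thesis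
    by (intro character_sum_eq_0[where w = "r *s axis i 1"]) auto
qed

text \<open>Counts \<open>\<Sum>u. \<Sum>t. \<psi> (t \<langle>u, y\<rangle>)\<close> in both orders.\<close>

lemma card_orthogonal:
  fixes y :: "'k ^ 3"
  assumes "y \<noteq> 0"
  shows "of_nat (card {u. scalar_product u y = 0}) = (of_nat CARD('k) :: complex)^2"
proof -
  have "of_nat (card {u. scalar_product u y = 0}) * (of_nat CARD('k) :: complex)
      = (\<Sum>u\<in>UNIV. \<Sum>t\<in>UNIV. \<psi> (t * scalar_product u y))"
    by (simp add: sum_psi_mult sum.If_cases)
  also have "\<dots> = (\<Sum>t\<in>UNIV. \<Sum>u\<in>UNIV. \<psi> (scalar_product u (t *s y)))"
    by (subst sum.swap) simp
  also have "\<dots> = (\<Sum>t\<in>(UNIV :: 'k set). if t = 0 then of_nat CARD('k) ^ 3 else 0)"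
    using assms by (intro sum.cong refl) (simp add: sum_psi_scalar_product psi_0 del: scalar_product_simps(2))
  finally show ?thesis by (simp add: power3_eq_cube power2_eq_square)
qed

text \<open>Orthogonality of characters on the plane: for \<open>x \<noteq> 0\<close> nondegeneracy
  provides a \<open>u\<close> whose multiples reach a nontrivial value of \<open>\<psi>\<close>; for
  \<open>x = 0\<close> the points of the plane are counted.\<close>

lemma sum_psi_cross_quot:
  assumes "scalar_product x y = 0" "y \<noteq> 0"
  shows "(\<Sum>u | scalar_product u y = 0. \<psi> (cross_quot u x y))
       = (if x = 0 then of_nat CARD('k) ^ 2 else 0)"
proof (cases "x = 0")
  case True
  have "cross_quot u x y = 0" for u using True assms by (intro cross_quot_eqI) simp_all
  then show ?thesis using True assms by (simp add: psi_0 card_orthogonal)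
next
  case False
  from cross_quot_nondegenerate[OF assms(1) False assms(2)]
  obtain u where u: "scalar_product u y = 0" "cross_quot u x y \<noteq> 0" .
  then obtain r where "\<psi> (r * cross_quot u x y) \<noteq> 1" using psi_nontrivial by blast
  then have "\<psi> (cross_quot (r *s u) x y) \<noteq> 1"
    using cross_quot_linear(3)[OF u(1) assms(1) u(1) assms(2)] by simp
  then have "(\<Sum>u | scalar_product u y = 0. \<psi> (cross_quot u x y)) = 0"
    using u assms by (intro character_sum_eq_0[where w = "r *s u"]) (auto intro!: cross_quot_linear)
  then show ?thesis using False by simp
qed

text \<open>Since the form is alternating, the two phases combine to the one of \<open>u\<close>
  against \<open>v - p\<close>. The sum over \<open>u\<close> is then concentrated at
  \<open>p = v\<close>, not at \<open>p = - v\<close> as it would be for a symmetric form.\<close>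

lemma BK12_BK12:
  assumes f: "f \<in> zero_avg"
  shows "BK12 \<psi> (BK12 \<psi> f) = (\<lambda>x. of_nat CARD('k) ^ 2 * f x)"
proof (rule ext, clarify)
  fix v y :: "'k ^ 3"
  let ?P = "{u. scalar_product u y = 0}"
  show "BK12 \<psi> (BK12 \<psi> f) (v, y) = of_nat CARD('k) ^ 2 * f (v, y)"
  proof (cases "scalar_product v y = 0 \<and> y \<noteq> 0")
    case True
    then have vy: "scalar_product v y = 0" "y \<noteq> 0" by auto
    have lin: "cross_quot p u y + cross_quot u v y = cross_quot u (v - p) y"
      if "u \<in> ?P" "p \<in> ?P" for u p
    proof -
      have u: "scalar_product u y = 0" and p: "scalar_product p y = 0" using that by auto
      have vp: "scalar_product (v - p) y = 0" using p vy by simp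
      show ?thesis
        using cross_quot_linear(4)[OF vy(1) u u vy(2)] cross_quot_linear(4)[OF vp u u vy(2)]
          cross_quot_linear(2)[OF vy(1) u p vy(2)] by simp
    qed
    have "BK12 \<psi> (BK12 \<psi> f) (v, y)
        = (\<Sum>u\<in>?P. (\<Sum>p\<in>?P. f (p, y) * \<psi> (cross_quot p u y)) * \<psi> (cross_quot u v y))"
      using vy by (simp add: BK12_def mem_quadric)
    also have "\<dots> = (\<Sum>u\<in>?P. \<Sum>p\<in>?P. f (p, y) * \<psi> (cross_quot u (v - p) y))"
      by (intro sum.cong refl) (simp add: sum_distrib_right mult.assoc lin flip: psi_add)
    also have "\<dots> = (\<Sum>p\<in>?P. f (p, y) * (\<Sum>u\<in>?P. \<psi> (cross_quot u (v - p) y)))"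
      by (subst sum.swap) (simp add: sum_distrib_left)
    also have "\<dots> = (\<Sum>p\<in>?P. if p = v then f (p, y) * of_nat CARD('k) ^ 2 else 0)"
      using vy by (intro sum.cong refl) (simp add: sum_psi_cross_quot)
    also have "\<dots> = of_nat CARD('k) ^ 2 * f (v, y)" using vy by simp
    finally show ?thesis .
  next
    case False
    then show ?thesis using zero_avgD(1)[OF f] zero_avg_0[OF f] by (auto simp: BK12_def mem_quadric)
  qed
qed

section \<open>The kernel of the threefold composition\<close>

lemma Kl_0: "Kl \<psi> 0 = - 1"
  using sum_psi_mult[of 1] by (simp add: Kl_def sum_diff1 psi_0)

text \<open>
  Substituting \<open>t = - 1 / c\<close> in \<^const>\<open>Kl\<close>, where \<open>c\<close> parametrises the multiples of the cross product
  \<open>y \<times> z\<close>.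
\<close>

lemma kernel_independent:
  fixes v y p z :: "'k ^ 3"
  assumes vy: "scalar_product v y = 0" and pz: "scalar_product p z = 0" and yz: "cross y z \<noteq> 0"
  shows "(\<Sum>u | scalar_product u y = 0 \<and> u \<noteq> 0 \<and> scalar_product u z = 0.
      \<psi> (cross_quot p u z + cross_quot z y u + cross_quot u v y))
    = Kl \<psi> (scalar_product p y + scalar_product v z)"
proof -
  have nz: "y \<noteq> 0" "z \<noteq> 0" using yz by auto
  have quots: "cross_quot p (c *s cross y z) z = - (c * scalar_product p y)"
     "cross_quot z y (c *s cross y z) = - (1 / c)"
     "cross_quot (c *s cross y z) v y = - (c * scalar_product v z)" if "c \<noteq> 0" for c
  proof -
    show "cross_quot p (c *s cross y z) z = - (c * scalar_product p y)"
      using nz pz by (intro cross_quot_eqI) (simp_all add: cross_cross_right vector_smult_assoc)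
    show "cross_quot z y (c *s cross y z) = - (1 / c)"
      using that yz by (intro cross_quot_eqI) (simp_all add: cross_anticommute[of z y] vector_smult_assoc)
    show "cross_quot (c *s cross y z) v y = - (c * scalar_product v z)"
      using nz vy
      by (intro cross_quot_eqI) (simp_all add: cross_cross_left vector_smult_assoc
          scalar_product_commute[of y v] scalar_product_commute[of z v])
  qed
  have "\<exists>c. u = c *s cross y z" if "scalar_product u y = 0" "scalar_product u z = 0" for u
  proof -
    have "cross u (cross y z) = 0" using that by (simp add: cross_cross_right)
    then show ?thesis using yz cross_eq_0_imp_multiple by metis
  qed
  then have "{u. scalar_product u y = 0 \<and> u \<noteq> 0 \<and> scalar_product u z = 0}
      = (\<lambda>c. c *s cross y z) ` (UNIV - {0})"
    using yz by (fastforce simp: image_iff)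
  moreover have "inj_on (\<lambda>c. c *s cross y z) (UNIV - {0})"
    using yz by (auto simp: inj_on_def vector_mul_rcancel)
  ultimately have "(\<Sum>u | scalar_product u y = 0 \<and> u \<noteq> 0 \<and> scalar_product u z = 0.
      \<psi> (cross_quot p u z + cross_quot z y u + cross_quot u v y))
    = (\<Sum>c\<in>UNIV - {0}. \<psi> ((scalar_product p y + scalar_product v z) / (- 1 / c) + - 1 / c))"
    by (simp add: sum.reindex quots) (intro sum.cong refl arg_cong[of _ _ \<psi>], simp add: algebra_simps)
  also have "\<dots> = Kl \<psi> (scalar_product p y + scalar_product v z)"
    unfolding Kl_def
    by (rule sum.reindex_bij_witness[of _ "\<lambda>t. - 1 / t" "\<lambda>c. - 1 / c"])
      auto
  finally show ?thesis .
qed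

text \<open>For parallel covectors the middle phase vanishes and both orthogonality conditions on
  \<open>u\<close> agree. The sum runs over a punctured plane, and \<open>- 1\<close> accounts for
  the missing term at \<open>u = 0\<close>.\<close>

lemma kernel_dependent:
  fixes v y p :: "'k ^ 3"
  assumes vy: "scalar_product v y = 0" and py: "scalar_product p y = 0" and "y \<noteq> 0" "l \<noteq> 0"
  shows "(\<Sum>u | scalar_product u y = 0 \<and> u \<noteq> 0 \<and> scalar_product u (l *s y) = 0.
      \<psi> (cross_quot p u (l *s y) + cross_quot (l *s y) y u + cross_quot u v y))
    = (if p = l *s v then of_nat CARD('k) ^ 2 else 0) - 1"
proof -
  \<comment> \<open>Dividing by \<open>l *s y\<close> instead of \<open>y\<close> contributes
    \<open>1 / l\<close>, so the outer two phases add up to \<open>cross_quot u x y\<close>.\<close>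
  define x where "x = v - (1 / l) *s p"
  have x: "scalar_product x y = 0" using vy py by (simp add: x_def)
  have "cross_quot p u (l *s y) + cross_quot (l *s y) y u + cross_quot u v y = cross_quot u x y"
    if u: "scalar_product u y = 0" "u \<noteq> 0" for u
  proof -
    have "cross_quot (l *s y) y u = 0" using u by (intro cross_quot_eqI) simp_all
    moreover have "cross_quot p u (l *s y) = - ((1 / l) * cross_quot u p y)"
      using cross_eq_cross_quot[OF u(1) py] assms
      by (intro cross_quot_eqI) (simp_all add: vector_smult_assoc cross_anticommute[of p u])
    moreover have "cross_quot u x y = cross_quot u v y - (1 / l) * cross_quot u p y"
      using cross_eq_cross_quot[OF u(1) py] cross_eq_cross_quot[OF u(1) vy] assms
      by (intro cross_quot_eqI) (simp_all add: x_def cross_add vector_sub_rdistrib vector_smult_assoc)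
    ultimately show ?thesis by simp
  qed
  then have "(\<Sum>u | scalar_product u y = 0 \<and> u \<noteq> 0 \<and> scalar_product u (l *s y) = 0.
      \<psi> (cross_quot p u (l *s y) + cross_quot (l *s y) y u + cross_quot u v y))
    = (\<Sum>u\<in>{u. scalar_product u y = 0} - {0}. \<psi> (cross_quot u x y))"
    by (intro sum.cong) auto
  moreover have "cross_quot 0 x y = 0" using assms by (intro cross_quot_eqI) simp_all
  moreover have "x = 0 \<longleftrightarrow> p = l *s v"
    using assms(4) by (auto simp: x_def vec_eq_iff field_simps)
  ultimately show ?thesis
    using sum_psi_cross_quot[OF x assms(3)] by (simp add: sum_diff1 psi_0)
qed

lemma Kl_transform_apply:
  assumes f: "f \<in> zero_avg" and "scalar_product v y = 0"
  shows "Kl_transform \<psi> f (v, y)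
    = (\<Sum>z\<in>UNIV. \<Sum>p\<in>UNIV. f (p, z) * Kl \<psi> (scalar_product p y + scalar_product v z))"
proof -
  have "Kl_transform \<psi> f (v, y)
      = (\<Sum>(p, z)\<in>quadric. f (p, z) * Kl \<psi> (scalar_product p y + scalar_product v z))"
    using assms by (simp add: Kl_transform_def mem_quadric)
  also have "\<dots> = (\<Sum>(p, z)\<in>UNIV \<times> UNIV. f (p, z) * Kl \<psi> (scalar_product p y + scalar_product v z))"
    by (rule sum.mono_neutral_left) (auto simp: mem_quadric zero_avgD(1)[OF f])
  also have "\<dots> = (\<Sum>p\<in>UNIV. \<Sum>z\<in>UNIV. f (p, z) * Kl \<psi> (scalar_product p y + scalar_product v z))"
    by (rule sum.cartesian_product[symmetric])
  finally show ?thesis by (subst sum.swap)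
qed

lemma BK12_BK23_BK12:
  assumes f: "f \<in> zero_avg"
  shows "BK12 \<psi> (BK23 \<psi> (BK12 \<psi> f)) = Kl_transform \<psi> f"
proof (rule ext, clarify)
  fix v y :: "'k ^ 3"
  note g = BK12_zero_avg[OF f, of \<psi>] and h = BK23_zero_avg[OF BK12_zero_avg[OF f]]
  show "BK12 \<psi> (BK23 \<psi> (BK12 \<psi> f)) (v, y) = Kl_transform \<psi> f (v, y)"
  proof (cases "scalar_product v y = 0 \<and> y \<noteq> 0")
    case False
    \<comment> \<open>At \<open>y = 0\<close> the left side is 0 by definition. On the right the
      kernel no longer depends on the first source component, over which \<open>f\<close> sums to
      0.\<close>
    have "Kl_transform \<psi> f (v, 0) = 0"
      using sum_zero_avg_fst[OF f]
      by (simp add: Kl_transform_apply[OF f] flip: sum_distrib_right)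
    then show ?thesis
      using False by (auto simp: BK12_def Kl_transform_def mem_quadric)
  next
    case True
    then have vy: "scalar_product v y = 0" and y: "y \<noteq> 0" by auto
    \<comment> \<open>The intermediate function vanishes at \<open>u = 0\<close> and off the
      quadric, so only these \<open>u\<close> contribute.\<close>
    define U where "U = {u. scalar_product u y = 0 \<and> u \<noteq> 0}"
    \<comment> \<open>The three phases collected along \<open>(p, z)\<close>, \<open>(u, z)\<close>,
      \<open>(u, y)\<close>, \<open>(v, y)\<close>.\<close>
    define e where "e p z u = cross_quot p u z + cross_quot z y u + cross_quot u v y" for p z u
    define K where "K p z = (\<Sum>u | scalar_product u y = 0 \<and> u \<noteq> 0 \<and> scalar_product u z = 0. \<psi> (e p z u))" for p z
    have BKg: "BK23 \<psi> (BK12 \<psi> f) (u, y) * \<psi> (cross_quot u v y)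
        = (\<Sum>z\<in>UNIV. \<Sum>p\<in>UNIV. if scalar_product u z = 0 then f (p, z) * \<psi> (e p z u) else 0)"
      if "u \<in> U" for u
    proof -
      have "BK12 \<psi> f (u, z) = (\<Sum>p\<in>UNIV. if scalar_product u z = 0 then f (p, z) * \<psi> (cross_quot p u z) else 0)"
        for z using BK12_apply[OF f, of u z] zero_avgD(1)[OF g, of u z]
        by (cases "scalar_product u z = 0") simp_all
      then show ?thesis
        using that unfolding U_def
        by (simp add: BK23_apply[OF g] sum_distrib_right e_def psi_add mult.assoc)
          (intro sum.cong refl, simp add: mult.assoc e_def psi_add)
    qed
    have inner: "(\<Sum>u\<in>U. if scalar_product u z = 0 then f (p, z) * \<psi> (e p z u) else 0) = f (p, z) * K p z"
      for z p
      unfolding K_def sum_distrib_left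
      by (rule sum.mono_neutral_cong_right) (auto simp: U_def)
    have "BK12 \<psi> (BK23 \<psi> (BK12 \<psi> f)) (v, y)
        = (\<Sum>u\<in>UNIV. BK23 \<psi> (BK12 \<psi> f) (u, y) * \<psi> (cross_quot u v y))"
      by (rule BK12_apply[OF h vy])
    also have "\<dots> = (\<Sum>u\<in>U. BK23 \<psi> (BK12 \<psi> f) (u, y) * \<psi> (cross_quot u v y))"
    proof (rule sum.mono_neutral_right)
      show "\<forall>u\<in>UNIV - U. BK23 \<psi> (BK12 \<psi> f) (u, y) * \<psi> (cross_quot u v y) = 0"
        using zero_avgD(1)[OF h, of _ y] zero_avg_0[OF h] by (auto simp: U_def)
    qed simp_all
    also have "\<dots> = (\<Sum>u\<in>U. \<Sum>z\<in>UNIV. \<Sum>p\<in>UNIV. if scalar_product u z = 0 then f (p, z) * \<psi> (e p z u) else 0)"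
      by (intro sum.cong refl BKg)
    also have "\<dots> = (\<Sum>z\<in>UNIV. \<Sum>u\<in>U. \<Sum>p\<in>UNIV. if scalar_product u z = 0 then f (p, z) * \<psi> (e p z u) else 0)"
      by (rule sum.swap)
    also have "\<dots> = (\<Sum>z\<in>UNIV. \<Sum>p\<in>UNIV. \<Sum>u\<in>U. if scalar_product u z = 0 then f (p, z) * \<psi> (e p z u) else 0)"
      by (intro sum.cong refl sum.swap)
    also have "\<dots> = (\<Sum>z\<in>UNIV. \<Sum>p\<in>UNIV. f (p, z) * K p z)"
      by (simp add: inner)
    \<comment> \<open>The kernel is the Kloosterman kernel plus \<open>q^2\<close> at the points
      obtained by scaling both components of \<open>(v, y)\<close> by a common nonzero
      \<open>l\<close>.\<close>
    also have "\<dots> = (\<Sum>z\<in>UNIV. \<Sum>p\<in>UNIV. f (p, z) * Kl \<psi> (scalar_product p y + scalar_product v z)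
        + of_nat CARD('k) ^ 2 * (if \<exists>l. l \<noteq> 0 \<and> z = l *s y \<and> p = l *s v then f (p, z) else 0))"
    proof (intro sum.cong refl)
      fix z p :: "'k ^ 3"
      \<comment> \<open>The first case absorbs \<open>z = 0\<close> and the pairs off the quadric,
        where the kernel lemmas do not apply.\<close>
      consider "f (p, z) = 0" | "z \<noteq> 0" "scalar_product p z = 0" "cross y z \<noteq> 0"
        | "z \<noteq> 0" "scalar_product p z = 0" "cross z y = 0"
        using zero_avg_0[OF f] zero_avgD(1)[OF f] cross_anticommute[of y z] by fastforce
      then show "f (p, z) * K p z = f (p, z) * Kl \<psi> (scalar_product p y + scalar_product v z)
        + of_nat CARD('k) ^ 2 * (if \<exists>l. l \<noteq> 0 \<and> z = l *s y \<and> p = l *s v then f (p, z) else 0)"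
      proof cases
        case 2
        then show ?thesis
          unfolding K_def e_def using kernel_independent[OF vy 2(2,3)] by auto
      next
        case 3
        obtain l where l: "z = l *s y" using cross_eq_0_imp_multiple[OF 3(3) y] .
        then have "l \<noteq> 0" "scalar_product p y = 0" using 3 by auto
        then have "K p z = (if p = l *s v then of_nat CARD('k) ^ 2 else 0) - 1"
          using kernel_dependent[OF vy _ y] unfolding K_def e_def l by blast
        moreover have "(\<exists>l. l \<noteq> 0 \<and> z = l *s y \<and> p = l *s v) \<longleftrightarrow> p = l *s v"
          using \<open>l \<noteq> 0\<close> y l by (auto simp: vector_mul_rcancel)
        moreover have "scalar_product p y + scalar_product v z = 0"
          using \<open>scalar_product p y = 0\<close> vy l by simp
        ultimately show ?thesis
          by (simp only: Kl_0) (simp add: right_diff_distrib mult.commute)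
      qed simp
    qed
    also have "\<dots> = Kl_transform \<psi> f (v, y) + of_nat CARD('k) ^ 2 *
        (\<Sum>z\<in>UNIV. \<Sum>p\<in>UNIV. if \<exists>l. l \<noteq> 0 \<and> z = l *s y \<and> p = l *s v then f (p, z) else 0)"
      by (simp add: Kl_transform_apply[OF f vy] sum.distrib sum_distrib_left)
    also have "(\<Sum>z\<in>UNIV. \<Sum>p\<in>UNIV. if \<exists>l. l \<noteq> 0 \<and> z = l *s y \<and> p = l *s v then f (p, z) else 0)
        = (\<Sum>x\<in>UNIV. if \<exists>l. l \<noteq> 0 \<and> fst x = l *s y \<and> snd x = l *s v then f (snd x, fst x) else 0)"
      by (simp add: sum.cartesian_product case_prod_unfold)
    also have "\<dots> = (\<Sum>x\<in>(\<lambda>l. (l *s y, l *s v)) ` (UNIV - {0}). f (snd x, fst x))"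
      by (rule sum.mono_neutral_cong_right) auto
    \<comment> \<open>As \<open>y\<close> is nonzero, each point determines its \<open>l\<close>;
      what remains is the third average at \<open>(v, y)\<close>.\<close>
    also have "\<dots> = (\<Sum>l\<in>UNIV - {0}. f (l *s v, l *s y))"
      using y by (subst sum.reindex) (auto simp: inj_on_def vector_mul_rcancel)
    also have "\<dots> = 0" by (rule zero_avgD(4)[OF f])
    finally show ?thesis by simp
  qed
qed

end

subsection \<open>The action of the Weyl group\<close>

abbreviation s12 :: "3 perm" where "s12 \<equiv> \<langle>1 \<leftrightarrow> 2\<rangle>"
abbreviation s23 :: "3 perm" where "s23 \<equiv> \<langle>2 \<leftrightarrow> 3\<rangle>"
abbreviation s13 :: "3 perm" where "s13 \<equiv> \<langle>1 \<leftrightarrow> 3\<rangle>"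

lemma swap_apply3 [simp]:
  "s12 \<langle>$\<rangle> 1 = 2" "s12 \<langle>$\<rangle> 2 = 1" "s12 \<langle>$\<rangle> 3 = 3"
  "s23 \<langle>$\<rangle> 1 = 1" "s23 \<langle>$\<rangle> 2 = 3" "s23 \<langle>$\<rangle> 3 = 2"
  "s13 \<langle>$\<rangle> 1 = 3" "s13 \<langle>$\<rangle> 2 = 2" "s13 \<langle>$\<rangle> 3 = 1"
  by simp_all

lemma perm3_eq_iff: "(p :: 3 perm) = r \<longleftrightarrow> p \<langle>$\<rangle> 1 = r \<langle>$\<rangle> 1 \<and> p \<langle>$\<rangle> 2 = r \<langle>$\<rangle> 2 \<and> p \<langle>$\<rangle> 3 = r \<langle>$\<rangle> 3"
  by (simp add: perm_eq_iff forall_3)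

lemma perm3_relations:
  "s12 * s12 = 1" "s23 * s23 = 1" "s23 * s12 * s23 = s12 * s23 * s12" "s13 = s12 * s23 * s12"
  by (simp_all add: perm3_eq_iff apply_times)

lemma perm3_cases:
  fixes p :: "3 perm"
  obtains "p = 1" | "p = s12" | "p = s23" | "p = s12 * s23" | "p = s23 * s12" | "p = s12 * s23 * s12"
proof -
  have "p \<langle>$\<rangle> 1 \<noteq> p \<langle>$\<rangle> 2" "p \<langle>$\<rangle> 1 \<noteq> p \<langle>$\<rangle> 3" "p \<langle>$\<rangle> 2 \<noteq> p \<langle>$\<rangle> 3"
    by (simp_all add: perm3_distinct)
  then have "p = 1 \<or> p = s12 \<or> p = s23 \<or> p = s12 * s23 \<or> p = s23 * s12 \<or> p = s12 * s23 * s12"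
    using exhaust_3[of "p \<langle>$\<rangle> 1"] exhaust_3[of "p \<langle>$\<rangle> 2"] exhaust_3[of "p \<langle>$\<rangle> 3"]
    by (elim disjE) (simp_all add: perm3_eq_iff apply_times)
  then show thesis using that by blast
qed

text \<open>Adjacency is right multiplication by a simple reflection, so this is induction along
  galleries.\<close>

lemma perm3_induct [case_names one s12 s23]:
  fixes p :: "3 perm"
  assumes "P 1" "\<And>p. P p \<Longrightarrow> P (p * s12)" "\<And>p. P p \<Longrightarrow> P (p * s23)"
  shows "P p"
  using assms(1) assms(2,3)[OF assms(1)] assms(2)[OF assms(3)[OF assms(1)]]
    assms(3)[OF assms(2)[OF assms(1)]] assms(2)[OF assms(3)[OF assms(2)[OF assms(1)]]]
  by (cases p rule: perm3_cases) simp_all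

definition norm_BK12 :: "('k::{field,finite} \<Rightarrow> complex) \<Rightarrow> ('k pt \<Rightarrow> complex) \<Rightarrow> 'k pt \<Rightarrow> complex" where
  "norm_BK12 \<psi> f = (\<lambda>x. BK12 \<psi> f x / of_nat CARD('k))"

definition norm_BK23 :: "('k::{field,finite} \<Rightarrow> complex) \<Rightarrow> ('k pt \<Rightarrow> complex) \<Rightarrow> 'k pt \<Rightarrow> complex" where
  "norm_BK23 \<psi> f = (\<lambda>x. BK23 \<psi> f x / of_nat CARD('k))"

section \<open>Equivariance under \<open>SL3\<close> and the torus\<close>

lemma dilate_zero_avg:
  assumes f: "f \<in> zero_avg" and "a \<noteq> 0" "b \<noteq> 0"
  shows "dilate a b f \<in> zero_avg"
proof -
  show ?thesis
    unfolding zero_avg_def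
    using zero_avgD(1)[OF f] zero_avgD(2-4)[OF f, of "a *s v" "b *s y" for v y]
      zero_avgD(2)[OF f, of "a *s v" "b *s y" for v y] assms(2,3)
    by (simp add: dilate_def mult.commute)
qed

lemma left_act_zero_avg:
  assumes f: "f \<in> zero_avg" and g: "g \<in> SL3"
  shows "f \<circ> left_act g \<in> zero_avg"
proof -
  let ?h = "matrix_inv g"
  have "scalar_product (g *v u) (y v* ?h) = scalar_product u y" for u y
    using SL3_inv[OF g] by (simp add: scalar_product_matrix vector_matrix_mul_assoc)
  moreover have "g *v (t *s v) = t *s (g *v v)" "(t *s v) v* ?h = t *s (v v* ?h)" for t v
    by (simp_all add: vec_eq_iff matrix_vector_mult_def vector_matrix_mult_def sum_distrib_left algebra_simps)
  ultimately show ?thesis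
    unfolding zero_avg_def using zero_avgD[OF f] by (simp add: left_act_def)
qed

lemma act_fun_eq:
  "act_fun w g t f = dilate (t $ (w \<langle>$\<rangle> 1) $ (w \<langle>$\<rangle> 1)) (inverse (t $ (w \<langle>$\<rangle> 3) $ (w \<langle>$\<rangle> 3))) f \<circ> left_act (matrix_inv g)"
  by (auto simp: act_fun_def dilate_def right_act_def fun_eq_iff left_act_def)

lemma prod_3: "prod f (UNIV :: 3 set) = f 1 * f 2 * f 3"
  unfolding UNIV_3 by (simp add: mult.assoc)

lemma torus_diagonal:
  fixes t :: "'k::field ^ 3 ^ 3"
  assumes "t \<in> torus"
  shows "t $ (w \<langle>$\<rangle> 1) $ (w \<langle>$\<rangle> 1) * t $ (w \<langle>$\<rangle> 2) $ (w \<langle>$\<rangle> 2) * t $ (w \<langle>$\<rangle> 3) $ (w \<langle>$\<rangle> 3) = 1"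
proof -
  have "det t = 1" and off: "\<And>i j. i \<noteq> j \<Longrightarrow> t $ i $ j = 0"
    using assms by (auto simp: torus_def SL3_def)
  have "(\<Prod>i\<in>UNIV. t $ (w \<langle>$\<rangle> i) $ (w \<langle>$\<rangle> i)) = (\<Prod>i\<in>UNIV. t $ i $ i)"
    by (rule prod.reindex_bij_betw) simp
  also have "\<dots> = det t" by (rule det_diagonal[symmetric]) (rule off)
  finally show ?thesis by (simp add: prod_3 \<open>det t = 1\<close>)
qed

lemma act_fun_zero_avg:
  assumes "f \<in> zero_avg" "g \<in> SL3" "t \<in> torus"
  shows "act_fun w g t f \<in> zero_avg"
  unfolding act_fun_eq using assms torus_diagonal[OF assms(3), of w]
  by (intro left_act_zero_avg dilate_zero_avg SL3_matrix_inv) auto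

text \<open>Since the determinant is 1, the middle diagonal entry \<open>c\<close> satisfies
  \<open>b / c = a\<close>, as \<open>dilate_BK12\<close> demands; multiplying \<open>w\<close> by
  \<open>s12\<close> on the right moves that entry to the first place.\<close>

lemma norm_BK12_equivariant:
  assumes "g \<in> SL3" "t \<in> torus"
  shows "norm_BK12 \<psi> (act_fun w g t f) = act_fun (w * s12) g t (norm_BK12 \<psi> f)"
proof -
  define a b c where "a = t $ (w \<langle>$\<rangle> 1) $ (w \<langle>$\<rangle> 1)" and "b = inverse (t $ (w \<langle>$\<rangle> 3) $ (w \<langle>$\<rangle> 3))"
    and "c = t $ (w \<langle>$\<rangle> 2) $ (w \<langle>$\<rangle> 2)"
  have "a * c * inverse b = 1" using torus_diagonal[OF assms(2), of w] by (simp add: a_def b_def c_def)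
  then have abc: "a \<noteq> 0" "b \<noteq> 0" "c \<noteq> 0" "b / c = a" by (auto simp: field_simps)
  have "BK12 \<psi> (act_fun w g t f) = dilate c b (BK12 \<psi> f) \<circ> left_act (matrix_inv g)"
    using abc by (simp add: act_fun_eq BK12_left_act SL3_matrix_inv assms dilate_BK12 flip: a_def b_def)
  then show ?thesis
    by (simp add: norm_BK12_def act_fun_eq apply_times dilate_def fun_eq_iff b_def c_def split: prod.split)
qed

lemma flip_dilate: "flip (dilate a b f) = dilate b a (flip f)"
  by (auto simp: flip_def dilate_def)

text \<open>Reduced to \<open>BK12\<close> by the exchange, with the inverse transpose as group
  element. The entry \<open>c\<close> is inverted because the torus scales covectors
  inversely.\<close>

lemma norm_BK23_equivariant:
  assumes "g \<in> SL3" "t \<in> torus"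
  shows "norm_BK23 \<psi> (act_fun w g t f) = act_fun (w * s23) g t (norm_BK23 \<psi> f)"
proof -
  define a b c where "a = t $ (w \<langle>$\<rangle> 1) $ (w \<langle>$\<rangle> 1)" and "b = inverse (t $ (w \<langle>$\<rangle> 3) $ (w \<langle>$\<rangle> 3))"
    and "c = inverse (t $ (w \<langle>$\<rangle> 2) $ (w \<langle>$\<rangle> 2))"
  have "a * inverse c * inverse b = 1" using torus_diagonal[OF assms(2), of w] by (simp add: a_def b_def c_def)
  then have abc: "a \<noteq> 0" "b \<noteq> 0" "c \<noteq> 0" "a / c = b" by (auto simp: field_simps)
  obtain g' where g': "g' \<in> SL3" "\<And>f. flip (f \<circ> left_act (matrix_inv g)) = flip f \<circ> left_act g'"
    "\<And>f. flip (f \<circ> left_act g') = flip f \<circ> left_act (matrix_inv g)"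
    using left_act_flip[OF SL3_matrix_inv[OF assms(1)]] by blast
  have "BK23 \<psi> (act_fun w g t f) = flip (dilate c a (BK12 \<psi> (flip f))) \<circ> left_act (matrix_inv g)"
    using abc by (simp add: BK23_flip act_fun_eq g' flip_dilate BK12_left_act dilate_BK12 flip: a_def b_def)
  also have "\<dots> = dilate a c (BK23 \<psi> f) \<circ> left_act (matrix_inv g)"
    by (simp add: flip_dilate BK23_flip)
  finally show ?thesis
    by (simp add: norm_BK23_def act_fun_eq apply_times dilate_def fun_eq_iff a_def c_def split: prod.split)
qed

text \<open>One reduced word is fixed for each permutation, the last branch being the longest
  element. Letters act from left to right, so the order of composition is reversed.\<close>

definition word_op :: "('k::{field,finite} \<Rightarrow> complex) \<Rightarrow> 3 perm \<Rightarrow> ('k pt \<Rightarrow> complex) \<Rightarrow> 'k pt \<Rightarrow> complex" where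
  "word_op \<psi> p =
    (if p = 1 then id else if p = s12 then norm_BK12 \<psi> else if p = s23 then norm_BK23 \<psi>
     else if p = s12 * s23 then norm_BK23 \<psi> \<circ> norm_BK12 \<psi>
     else if p = s23 * s12 then norm_BK12 \<psi> \<circ> norm_BK23 \<psi>
     else norm_BK12 \<psi> \<circ> norm_BK23 \<psi> \<circ> norm_BK12 \<psi>)"

lemma word_op_simps:
  "word_op \<psi> 1 f = f" "word_op \<psi> s12 f = norm_BK12 \<psi> f" "word_op \<psi> s23 f = norm_BK23 \<psi> f"
  "word_op \<psi> (s12 * s23) f = norm_BK23 \<psi> (norm_BK12 \<psi> f)"
  "word_op \<psi> (s23 * s12) f = norm_BK12 \<psi> (norm_BK23 \<psi> f)"
  "word_op \<psi> (s12 * s23 * s12) f = norm_BK12 \<psi> (norm_BK23 \<psi> (norm_BK12 \<psi> f))"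
  by (simp_all add: word_op_def perm3_eq_iff apply_times)

lemma norm_zero_avg:
  assumes "f \<in> zero_avg"
  shows "norm_BK12 \<psi> f \<in> zero_avg" "norm_BK23 \<psi> f \<in> zero_avg"
  using assms by (simp_all add: norm_BK12_def norm_BK23_def zero_avg_lincomb(3) BK12_zero_avg BK23_zero_avg)

lemma norm_BK23_flip: "norm_BK23 \<psi> f = flip (norm_BK12 \<psi> (flip f))"
  by (auto simp: norm_BK23_def norm_BK12_def BK23_flip flip_def)

lemma norm_BK_lincomb:
  "norm_BK12 \<psi> (\<lambda>x. f x + g x) = (\<lambda>x. norm_BK12 \<psi> f x + norm_BK12 \<psi> g x)"
  "norm_BK12 \<psi> (\<lambda>x. c * f x) = (\<lambda>x. c * norm_BK12 \<psi> f x)"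
  "norm_BK23 \<psi> (\<lambda>x. f x + g x) = (\<lambda>x. norm_BK23 \<psi> f x + norm_BK23 \<psi> g x)"
  "norm_BK23 \<psi> (\<lambda>x. c * f x) = (\<lambda>x. c * norm_BK23 \<psi> f x)"
proof -
  show *: "norm_BK12 \<psi> (\<lambda>x. f x + g x) = (\<lambda>x. norm_BK12 \<psi> f x + norm_BK12 \<psi> g x)"
    "norm_BK12 \<psi> (\<lambda>x. c * f x) = (\<lambda>x. c * norm_BK12 \<psi> f x)" for f g c
    by (simp_all add: norm_BK12_def BK12_lincomb add_divide_distrib)
  have "flip (\<lambda>x. f x + g x) = (\<lambda>x. flip f x + flip g x)" "flip (\<lambda>x. c * f x) = (\<lambda>x. c * flip f x)"
    for f g :: "'a pt \<Rightarrow> complex" and c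
    by (auto simp: flip_def)
  then show "norm_BK23 \<psi> (\<lambda>x. f x + g x) = (\<lambda>x. norm_BK23 \<psi> f x + norm_BK23 \<psi> g x)"
    "norm_BK23 \<psi> (\<lambda>x. c * f x) = (\<lambda>x. c * norm_BK23 \<psi> f x)"
    by (simp_all add: norm_BK23_flip *)
qed

section \<open>Relations among the normalized transforms\<close>

context
  fixes \<psi> :: "'k::{field,finite} \<Rightarrow> complex"
  assumes \<psi>: "nontrivial_additive_character \<psi>"
begin

lemma norm_BK12_involution:
  assumes "f \<in> zero_avg"
  shows "norm_BK12 \<psi> (norm_BK12 \<psi> f) = f"
  by (simp add: norm_BK12_def BK12_lincomb BK12_BK12[OF \<psi> assms] power2_eq_square)

lemma norm_BK23_involution: "f \<in> zero_avg \<Longrightarrow> norm_BK23 \<psi> (norm_BK23 \<psi> f) = f"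
  by (simp add: norm_BK23_flip norm_BK12_involution flip_zero_avg)

lemma norm_BK_Kl_transform:
  assumes "f \<in> zero_avg"
  shows "norm_BK12 \<psi> (norm_BK23 \<psi> (norm_BK12 \<psi> f)) = (\<lambda>x. Kl_transform \<psi> f x / of_nat CARD('k) ^ 3)"
proof -
  have "BK23 \<psi> (\<lambda>x. f x / c) = (\<lambda>x. BK23 \<psi> f x / c)" for f c
  proof -
    have "flip (\<lambda>x. f x / c) = (\<lambda>x. flip f x / c)" for f :: "'k pt \<Rightarrow> complex"
      by (auto simp: flip_def)
    then show ?thesis by (simp add: BK23_flip BK12_lincomb)
  qed
  then show ?thesis
    by (simp add: norm_BK12_def norm_BK23_def BK12_lincomb BK12_BK23_BK12[OF \<psi> assms] power3_eq_cube)
qed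

text \<open>Conjugation by the exchange turns one side into the other, and the Kloosterman transform
  commutes with the exchange.\<close>

lemma norm_BK_braid:
  assumes "f \<in> zero_avg"
  shows "norm_BK23 \<psi> (norm_BK12 \<psi> (norm_BK23 \<psi> f)) = norm_BK12 \<psi> (norm_BK23 \<psi> (norm_BK12 \<psi> f))"
proof -
  have "norm_BK23 \<psi> (norm_BK12 \<psi> (norm_BK23 \<psi> f))
      = flip (norm_BK12 \<psi> (norm_BK23 \<psi> (norm_BK12 \<psi> (flip f))))"
    by (simp add: norm_BK23_flip)
  also have "\<dots> = (\<lambda>x. Kl_transform \<psi> f x / of_nat CARD('k) ^ 3)"
    using norm_BK_Kl_transform[OF flip_zero_avg[OF assms]]
    by (simp add: Kl_transform_flip) (simp add: flip_def fun_eq_iff)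
  finally show ?thesis by (simp add: norm_BK_Kl_transform[OF assms])
qed

lemma word_op_zero_avg: "f \<in> zero_avg \<Longrightarrow> word_op \<psi> p f \<in> zero_avg"
  by (cases p rule: perm3_cases) (simp_all add: word_op_simps norm_zero_avg)

text \<open>An appended letter lengthens the chosen word, cancels its last letter or calls for the
  braid relation. The chosen longest word ends in \<open>s12\<close>, so the braid relation enters
  only for \<open>s23\<close>.\<close>

lemma word_op_step:
  assumes "f \<in> zero_avg"
  shows "word_op \<psi> (p * s12) f = norm_BK12 \<psi> (word_op \<psi> p f)"
    and "word_op \<psi> (p * s23) f = norm_BK23 \<psi> (word_op \<psi> p f)"
proof -
  note rel = norm_BK12_involution norm_BK23_involution norm_BK_braid norm_zero_avg
  have assoc: "r * s12 * s12 = r" "r * s23 * s23 = r" for r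
    by (simp_all add: mult.assoc perm3_relations)
  have braid: "s12 * s23 * s12 * s23 = s23 * s12"
    by (metis assoc perm3_relations(3))
  show "word_op \<psi> (p * s12) f = norm_BK12 \<psi> (word_op \<psi> p f)"
    by (cases p rule: perm3_cases) (simp_all add: word_op_simps assoc perm3_relations(1) rel assms)
  show "word_op \<psi> (p * s23) f = norm_BK23 \<psi> (word_op \<psi> p f)"
  proof (cases p rule: perm3_cases)
    case 6
    \<comment> \<open>The braid relation rewrites the longest word to end in \<open>s23\<close>,
      which then cancels.\<close>
    have "norm_BK23 \<psi> (word_op \<psi> p f) = norm_BK23 \<psi> (norm_BK23 \<psi> (norm_BK12 \<psi> (norm_BK23 \<psi> f)))"
      by (simp add: 6 word_op_simps norm_BK_braid assms)
    then show ?thesis by (simp add: 6 braid word_op_simps rel assms)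
  qed (simp_all add: word_op_simps assoc perm3_relations(2,3) rel assms)
qed

lemma word_op_mult:
  assumes "f \<in> zero_avg"
  shows "word_op \<psi> (p * r) f = word_op \<psi> r (word_op \<psi> p f)"
  by (induction r rule: perm3_induct)
    (simp_all add: word_op_simps word_op_step word_op_zero_avg assms flip: mult.assoc)

lemma word_op_lincomb:
  assumes "f \<in> zero_avg" "g \<in> zero_avg"
  shows "word_op \<psi> p (\<lambda>x. f x + g x) = (\<lambda>x. word_op \<psi> p f x + word_op \<psi> p g x)"
    "word_op \<psi> p (\<lambda>x. c * f x) = (\<lambda>x. c * word_op \<psi> p f x)"
  by (cases p rule: perm3_cases; simp add: word_op_simps norm_BK_lincomb)+

lemma word_op_equivariant:
  assumes "f \<in> zero_avg" "g \<in> SL3" "t \<in> torus"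
  shows "word_op \<psi> p (act_fun w g t f) = act_fun (w * p) g t (word_op \<psi> p f)"
  by (induction p rule: perm3_induct)
    (simp_all add: word_op_simps word_op_step act_fun_zero_avg assms norm_BK12_equivariant
      norm_BK23_equivariant flip: mult.assoc)

lemma BK_adjacent:
  "(\<lambda>x. BK \<psi> (w * s12) w f x / of_nat CARD('k)) = norm_BK12 \<psi> f"
  "(\<lambda>x. BK \<psi> (w * s23) w f x / of_nat CARD('k)) = norm_BK23 \<psi> f"
proof -
  \<comment> \<open>\<open>BK\<close> tests only for the first reflection, so the two neighbours of
    \<open>w\<close> must be told apart.\<close>
  have "w * s23 \<noteq> w * s12" by (simp add: perm3_eq_iff apply_times perm3_distinct)
  then show "(\<lambda>x. BK \<psi> (w * s12) w f x / of_nat CARD('k)) = norm_BK12 \<psi> f"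
    "(\<lambda>x. BK \<psi> (w * s23) w f x / of_nat CARD('k)) = norm_BK23 \<psi> f"
    by (simp_all add: BK_def norm_BK12_def norm_BK23_def)
qed

section \<open>Existence and uniqueness of the family\<close>

lemma intertwining_family_exists:
  "intertwining_family \<psi> (\<lambda>w' w. restrict (word_op \<psi> (inverse w * w')) (S' w))"
proof -
  \<comment> \<open>\<open>inverse w * w'\<close> is the position of \<open>w'\<close> relative to
    \<open>w\<close>. Relative positions multiply along a chain, which turns
    \<open>word_op_mult\<close> into the composition law.\<close>
  have cancel: "w * (inverse w * w') = w'" "inverse w * (w * w') = w'"
    "inverse w * w' * (inverse w' * w'') = inverse w * w''" for w w' w'' :: "3 perm"
    by (simp_all add: mult.assoc[symmetric]) (simp add: mult.assoc)
  have "linear_on_S' w (restrict (word_op \<psi> p) (S' w))" for w p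
    by (simp add: linear_on_S'_def S'_eq_zero_avg zero_avg_lincomb word_op_lincomb)
  moreover have "equivariant_on_S' w' w (restrict (word_op \<psi> (inverse w * w')) (S' w))" for w w'
    using word_op_equivariant[of _ _ _ "inverse w * w'" w]
    by (simp add: equivariant_on_S'_def S'_eq_zero_avg act_fun_zero_avg cancel)
  moreover have "word_op \<psi> (inverse w' * w'') (word_op \<psi> (inverse w * w') f) = word_op \<psi> (inverse w * w'') f"
    if "f \<in> zero_avg" for f w w' w''
    using word_op_mult[OF that, of "inverse w * w'" "inverse w' * w''"] by (simp add: cancel)
  moreover have "word_op \<psi> (inverse w * w') f = (\<lambda>x. BK \<psi> w' w f x / of_nat CARD('k))"
    if "adjacent w w'" for f w w'
    using that by (auto simp: adjacent_def cancel word_op_simps BK_adjacent)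
  ultimately show ?thesis
    by (simp add: intertwining_family_def S'_eq_zero_avg word_op_zero_avg word_op_simps)
qed

text \<open>The composition law splits the operator along a gallery from \<open>w\<close> to
  \<open>w * p\<close>, and each step of the gallery is prescribed by the adjacency
  condition.\<close>

lemma intertwining_family_apply:
  assumes F: "intertwining_family \<psi> F" and f: "f \<in> zero_avg"
  shows "F (w * p) w f = word_op \<psi> p f"
proof (induction p rule: perm3_induct)
  case one
  then show ?case using F f by (simp add: intertwining_family_def S'_eq_zero_avg word_op_simps)
next
  case (s12 p)
  have "F (w * (p * s12)) w f = F (w * (p * s12)) (w * p) (F (w * p) w f)"
    using F f by (simp add: intertwining_family_def S'_eq_zero_avg)
  also have "\<dots> = norm_BK12 \<psi> (word_op \<psi> p f)"
    using F f word_op_zero_avg[OF f, of p]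
    by (simp add: s12 intertwining_family_def S'_eq_zero_avg adjacent_def BK_adjacent flip: mult.assoc)
  finally show ?case by (simp add: word_op_step f)
next
  case (s23 p)
  have "F (w * (p * s23)) w f = F (w * (p * s23)) (w * p) (F (w * p) w f)"
    using F f by (simp add: intertwining_family_def S'_eq_zero_avg)
  also have "\<dots> = norm_BK23 \<psi> (word_op \<psi> p f)"
    using F f word_op_zero_avg[OF f, of p]
    by (simp add: s23 intertwining_family_def S'_eq_zero_avg adjacent_def BK_adjacent flip: mult.assoc)
  finally show ?case by (simp add: word_op_step f)
qed

lemma intertwining_family_unique:
  assumes F: "intertwining_family \<psi> F"
  shows "F = (\<lambda>w' w. restrict (word_op \<psi> (inverse w * w')) (S' w))"
proof (rule ext, rule ext, rule ext)
  fix w' w :: "3 perm" and f :: "'k pt \<Rightarrow> complex"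
  have "F w' w f = word_op \<psi> (inverse w * w') f" if "f \<in> S' w"
    using intertwining_family_apply[OF F, of f w "inverse w * w'"] that
    by (simp add: S'_eq_zero_avg flip: mult.assoc)
  \<comment> \<open>Outside \<open>S' w\<close> the extensional function space and
    \<open>restrict\<close> yield the same default value.\<close>
  moreover have "F w' w f = undefined" if "f \<notin> S' w"
    using F that unfolding intertwining_family_def by (meson PiE_arb)
  ultimately show "F w' w f = restrict (word_op \<psi> (inverse w * w')) (S' w) f"
    by (simp add: fun_eq_iff restrict_def)
qed

end

theorem theorem7p2:
  fixes \<psi> :: "'k::{field,finite} \<Rightarrow> complex"
  assumes "nontrivial_additive_character \<psi>"
  shows "(\<exists>!F. intertwining_family \<psi> F) \<and>
    (\<forall>F. intertwining_family \<psi> F \<longrightarrow>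
      (\<forall>w w'. opposite w w' \<longrightarrow>
        (\<forall>f \<in> S' w. F w' w f = (\<lambda>x. Kl_transform \<psi> f x / of_nat CARD('k) ^ 3))))"
proof (intro conjI allI impI ballI)
  show "\<exists>!F. intertwining_family \<psi> F"
    using intertwining_family_exists[OF assms] intertwining_family_unique[OF assms] by blast
next
  fix F w w' and f :: "'k pt \<Rightarrow> complex"
  assume F: "intertwining_family \<psi> F" and "opposite w w'" and "f \<in> S' w"
  \<comment> \<open>The transposition joining opposite Borel subgroups is the longest element,
    written as the word that gives the Kloosterman transform.\<close>
  then have "w' = w * (s12 * s23 * s12)" "f \<in> zero_avg"
    by (simp_all only: opposite_def perm3_relations(4) S'_eq_zero_avg)
  then show "F w' w f = (\<lambda>x. Kl_transform \<psi> f x / of_nat CARD('k) ^ 3)"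
    using intertwining_family_apply[OF assms F]
    by (simp add: word_op_simps norm_BK_Kl_transform[OF assms])
qed

end
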